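(* For each $d_x\in\mathbb N$ let $X\sim\pi_0=\mathcal N(\mu_x^{d_x},\Sigma_x^{d_x})$ on $\mathbb R^{d_x}$ with $\Sigma_x^{d_x}$ positive definite, and let $Y=A^{d_x}X+V$, where $A^{d_x}\in\mathbb R^{d_y\times d_x}$ and $V\sim\mathcal N(0,R)$ is independent of $X$, with $R\in\mathbb R^{d_y\times d_y}$ positive definite and independent of $d_x$. Then, for every $d_x$: (a) $$K_2^{d_x}=\mathbb E\big[\|\ell_Y^{\,d_x}\|_{L^2(\pi_0)}^2\big]=\frac{\big|A^{d_x}\Sigma_x^{d_x}(A^{d_x})^\top+R\big|}{|R|}<\infty.$$ (b) $$K_2^{d_x}\le\left(1+\frac{\lambda_1(\Sigma_x^{d_x})}{\lambda_{d_y}(R)}\,\sigma_1^2(A^{d_x})\right)^{d_y}.$$ Consequently: (c) If there are polynomials $P_{n_A}$ and $P_{n_\Sigma}$ of degrees $n_A,n_\Sigma\in\mathbb N$ such that $\sigma_1(A^{d_x})\le P_{n_A}(d_x)$ and $\lambda_1(\Sigma_x^{d_x})\le P_{n_\Sigma}(d_x)$ for all $d_x$, then $K_2^{d_x}\le P_n(d_x)$ for all $d_x$, where $P_n$ is a polynomial of degree $n=(2n_A+n_\Sigma)d_y$. (d) If $C_A:=\sup_{d_x}\sigma_1(A^{d_x})<\infty$ and $C_\Sigma:=\sup_{d_x}\lambda_1(\Sigma_x^{d_x})<\infty$, then $K_2^{d_x}\le\mathcal K_2:=\left(1+\frac{C_\Sigma C_A^2}{\lambda_{d_y}(R)}\right)^{d_y}$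 for all $d_x$.
   Context: $|\cdot|$ denotes the determinant of a matrix; $\lambda_1(\cdot)$ and $\lambda_{d_y}(\cdot)$ denote the largest eigenvalue and (for a $d_y\times d_y$ symmetric matrix) the smallest eigenvalue; $\sigma_1(\cdot)$ denotes the largest singular value. The observation dimension $d_y$ is fixed. The likelihood $g_y^{d_x}(x)$ is the density at $y$ of $\mathcal N(A^{d_x}x,R)$, and $\pi_0(g_y^{d_x}):=\int g_y^{d_x}(x)\,\pi_0(\mathrm dx)$ is the density of $Y$; $\eta(\mathrm dy)=\pi_0(g_y^{d_x})\,\mathrm dy$. The link function is $\ell_y^{\,d_x}:=g_y^{d_x}(\cdot)/\pi_0(g_y^{d_x})\in L^2(\pi_0)$, and $K_2^{d_x}:=\int_{\mathbb R^{d_y}}\|\ell_y^{\,d_x}\|_{L^2(\pi_0)}^2\,\eta(\mathrm dy)$. *)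

theory Defs
  imports
    "HOL-Probability.Probability"
    "HOL-Computational_Algebra.Polynomial"
    "Jordan_Normal_Form.Char_Poly"
    "Jordan_Normal_Form.Gauss_Jordan_Elimination"
begin

text \<open>
  The dimension of the state space varies inside the statement, so vectors and matrices are those of
  Jordan_Normal_Form, whose dimension is a number. The names \<open>vec\<close>, \<open>mat\<close>, \<open>det\<close> also exist in
  HOL-Analysis and are therefore qualified.
\<close>

definition pos_def_mat :: "nat \<Rightarrow> real Matrix.mat \<Rightarrow> bool" where
  "pos_def_mat n S \<longleftrightarrow> S \<in> carrier_mat n n \<and> transpose_mat S = S \<and>
     (\<forall>v\<in>carrier_vec n. v \<noteq> 0\<^sub>v n \<longrightarrow> scalar_prod v (S *\<^sub>v v) > 0)"

text \<open>Meaningful for symmetric matrices of positive size, whose spectrum is real, finite and nonempty.\<close>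

definition max_eigenvalue :: "real Matrix.mat \<Rightarrow> real" where
  "max_eigenvalue S = Max {k. eigenvalue S k}"

definition min_eigenvalue :: "real Matrix.mat \<Rightarrow> real" where
  "min_eigenvalue S = Min {k. eigenvalue S k}"

definition max_singular_value :: "real Matrix.mat \<Rightarrow> real" where
  "max_singular_value A = sqrt (max_eigenvalue (transpose_mat A * A))"

text \<open>Lebesgue measure on \<open>carrier_vec n\<close>: the product measure on coordinate functions, transported
  along \<open>vec n\<close>.\<close>

definition lborel_vec :: "nat \<Rightarrow> real Matrix.vec measure" where
  "lborel_vec n = embed_measure (\<Pi>\<^sub>M i\<in>{..<n}. (lborel :: real measure)) (Matrix.vec n)"

lemma space_lborel_vec: "space (lborel_vec n) = carrier_vec n"
proof -
  have "v \<in> Matrix.vec n ` ({..<n} \<rightarrow>\<^sub>E UNIV)" if "v \<in> carrier_vec n" for v :: "real Matrix.vec"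
    using that
    by (intro image_eqI[where x = "restrict (\<lambda>i. vec_index v i) {..<n}"]) auto
  then show ?thesis
    by (auto simp: lborel_vec_def space_embed_measure space_PiM)
qed

text \<open>Density and law of \<open>N(m, S)\<close> for positive definite \<open>S\<close>.\<close>

definition gaussian_density :: "real Matrix.vec \<Rightarrow> real Matrix.mat \<Rightarrow> real Matrix.vec \<Rightarrow> real" where
  "gaussian_density m S x =
     exp (- scalar_prod (x - m) (the (mat_inverse S) *\<^sub>v (x - m)) / 2) /
     sqrt ((2 * pi) ^ dim_vec m * Determinant.det S)"

definition gaussian :: "real Matrix.vec \<Rightarrow> real Matrix.mat \<Rightarrow> real Matrix.vec measure" where
  "gaussian m S = density (lborel_vec (dim_vec m)) (\<lambda>x. ennreal (gaussian_density m S x))"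

text \<open>In the following, \<open>\<pi>0\<close> is the prior; \<open>evidence A R \<pi>0 y\<close> is \<open>\<pi>0(g\<^sub>y)\<close>, the density of \<open>Y\<close>,
  and \<open>evidence_law A R \<pi>0\<close> is the measure \<open>\<eta>\<close>.\<close>

definition likelihood ::
    "real Matrix.mat \<Rightarrow> real Matrix.mat \<Rightarrow> real Matrix.vec \<Rightarrow> real Matrix.vec \<Rightarrow> real" where
  "likelihood A R y x = gaussian_density (A *\<^sub>v x) R y"

definition evidence ::
    "real Matrix.mat \<Rightarrow> real Matrix.mat \<Rightarrow> real Matrix.vec measure \<Rightarrow> real Matrix.vec \<Rightarrow> real" where
  "evidence A R \<pi>0 y = (\<integral>x. likelihood A R y x \<partial>\<pi>0)"

definition evidence_law ::
    "real Matrix.mat \<Rightarrow> real Matrix.mat \<Rightarrow> real Matrix.vec measure \<Rightarrow> real Matrix.vec measure" where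
  "evidence_law A R \<pi>0 = density (lborel_vec (dim_row A)) (\<lambda>y. ennreal (evidence A R \<pi>0 y))"

definition link ::
    "real Matrix.mat \<Rightarrow> real Matrix.mat \<Rightarrow> real Matrix.vec measure \<Rightarrow>
     real Matrix.vec \<Rightarrow> real Matrix.vec \<Rightarrow> real" where
  "link A R \<pi>0 y x = likelihood A R y x / evidence A R \<pi>0 y"

text \<open>Squared L2 norms and \<open>K\<^sub>2\<close> take extended values, so that their finiteness is part of what has to be
  proved.\<close>

definition L2_norm_sq :: "'a measure \<Rightarrow> ('a \<Rightarrow> real) \<Rightarrow> ennreal" where
  "L2_norm_sq \<mu> f = (\<integral>\<^sup>+x. ennreal ((f x)\<^sup>2) \<partial>\<mu>)"

definition K2 :: "real Matrix.mat \<Rightarrow> real Matrix.mat \<Rightarrow> real Matrix.vec measure \<Rightarrow> ennreal" where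
  "K2 A R \<pi>0 = (\<integral>\<^sup>+y. L2_norm_sq \<pi>0 (link A R \<pi>0 y) \<partial>evidence_law A R \<pi>0)"

end

(* Completing the square shows that the evidence of y is c N(y; A mu, S) with S = A Sigma A^T + R,
   and c = 1 because both sides are probability densities in y. The square of N(y; A x, R) is a
   constant multiple of N(y; A x, R/2), so the same computation with T = A Sigma A^T + R/2 in place
   of S turns K_2 into a constant times the integral of N(y; A mu, T) / N(y; A mu, S). This is again
   a Gaussian integral, with quadratic form T^-1 - S^-1 = T^-1 (R/2) S^-1, and it evaluates to
   |S| / |R|. The upper bound follows from the Loewner inequality
   S <= (1 + lambda_1(Sigma) sigma_1(A)^2 / lambda_min(R)) R. *)

theory Submission
  imports Defs
begin

unbundle no inner_syntax
unbundle no vec_syntax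
hide_const (open) Determinants.det Finite_Cartesian_Product.mat Finite_Cartesian_Product.vec
hide_type (open) Finite_Cartesian_Product.vec

section \<open>Positive definite matrices\<close>

text \<open>Determinants are controlled throughout by Gaussian integrals. The comparison of total
  masses that yields c = 1 stands in for the identity |S| = |R| |\<Sigma>| |\<Sigma>^-1 + A^T R^-1
  A|, and the passage from the Loewner inequality to determinants uses that a larger form has a
  smaller integral of exp(- v \<bullet> P v / 2). That integral is computed by eliminating one
  coordinate at a time: Schur complements give the integral and the determinant the same recursion
  in the dimension, and translations are the only changes of variables in Lebesgue integrals.
  Extremal eigenvalues are reached through Rayleigh quotients. Finiteness of K_2 rests on T^-1 -
  S^-1 being positive definite. This holds because S exceeds T by R / 2, which is strictly positive,
  and inversion reverses the order. The half comes from squaring the likelihood: a doubled exponent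
  is a halved covariance.\<close>

abbreviation inv_mat :: "real mat \<Rightarrow> real mat" where
  "inv_mat S \<equiv> the (mat_inverse S)"

text \<open>The prior contribution A \<Sigma> A^T is only semidefinite when A^T has a kernel, and k
  I - S at the largest Rayleigh quotient k of S is always degenerate.\<close>

definition psd_mat :: "nat \<Rightarrow> real mat \<Rightarrow> bool" where
  "psd_mat n S \<longleftrightarrow> S \<in> carrier_mat n n \<and> transpose_mat S = S \<and>
     (\<forall>v\<in>carrier_vec n. v \<bullet> (S *\<^sub>v v) \<ge> 0)"

lemma symmetric_bilinear_commute:
  fixes S :: "real mat"
  assumes "S \<in> carrier_mat n n" "transpose_mat S = S" "u \<in> carrier_vec n" "v \<in> carrier_vec n"
  shows "u \<bullet> (S *\<^sub>v v) = v \<bullet> (S *\<^sub>v u)"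
proof -
  have "u \<bullet> (S *\<^sub>v v) = (S *\<^sub>v u) \<bullet> v"
    using transpose_vec_mult_scalar[OF assms(1,4,3)] assms(2) by simp
  also have "\<dots> = v \<bullet> (S *\<^sub>v u)"
    using assms by (intro comm_scalar_prod) auto
  finally show ?thesis .
qed

lemma mult_mat_zero_vec:
  fixes S :: "real mat"
  shows "S \<in> carrier_mat m n \<Longrightarrow> S *\<^sub>v 0\<^sub>v n = 0\<^sub>v m"
  by (intro eq_vecI) auto

lemma quadratic_form_add:
  fixes S :: "real mat"
  assumes S: "S \<in> carrier_mat n n" "transpose_mat S = S"
    and u: "u \<in> carrier_vec n" and v: "v \<in> carrier_vec n"
  shows "(u + v) \<bullet> (S *\<^sub>v (u + v)) = u \<bullet> (S *\<^sub>v u) + 2 * (u \<bullet> (S *\<^sub>v v)) + v \<bullet> (S *\<^sub>v v)"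
proof -
  have c: "S *\<^sub>v u \<in> carrier_vec n" "S *\<^sub>v v \<in> carrier_vec n"
    using S u v by auto
  show ?thesis
    using u v c symmetric_bilinear_commute[OF S u v]
    by (simp add: mult_add_distrib_mat_vec[OF S(1) u v] add_scalar_prod_distrib[of _ n]
        scalar_prod_add_distrib[of _ n])
qed

lemma quadratic_form_smult:
  fixes S :: "real mat"
  assumes S: "S \<in> carrier_mat n n" and v: "v \<in> carrier_vec n"
  shows "(a \<cdot>\<^sub>v v) \<bullet> (S *\<^sub>v (a \<cdot>\<^sub>v v)) = a\<^sup>2 * (v \<bullet> (S *\<^sub>v v))"
proof -
  have "S *\<^sub>v v \<in> carrier_vec n" using S v by auto
  then show ?thesis
    using v by (simp add: mult_mat_vec[OF S v] power2_eq_square)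
qed

lemma scalar_prod_self_nonneg: "(v :: real vec) \<bullet> v \<ge> 0"
  by (auto simp: scalar_prod_def intro!: sum_nonneg)

lemma scalar_prod_self_pos:
  assumes "(v :: real vec) \<in> carrier_vec n" "v \<noteq> 0\<^sub>v n"
  shows "v \<bullet> v > 0"
proof -
  obtain i where i: "i < n" "v $ i \<noteq> 0"
    using assms by (metis carrier_vecD dim_vec eq_vecI index_zero_vec(1) index_zero_vec(2))
  have "0 < (v $ i) * (v $ i)" using i by (metis not_real_square_gt_zero)
  also have "\<dots> \<le> v \<bullet> v"
    unfolding scalar_prod_def using i assms by (intro member_le_sum) auto
  finally show ?thesis .
qed

lemma pos_def_mat_imp_psd: "pos_def_mat n S \<Longrightarrow> psd_mat n S"
  unfolding pos_def_mat_def psd_mat_def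
  by (metis less_eq_real_def mult_mat_vec_carrier scalar_prod_left_zero)

lemma pos_def_mat_carrier: "pos_def_mat n S \<Longrightarrow> S \<in> carrier_mat n n"
  by (simp add: pos_def_mat_def)

lemma pos_def_mat_sym: "pos_def_mat n S \<Longrightarrow> transpose_mat S = S"
  by (simp add: pos_def_mat_def)

lemma pos_def_mat_kernel:
  assumes "pos_def_mat n S" "v \<in> carrier_vec n" "S *\<^sub>v v = 0\<^sub>v n"
  shows "v = 0\<^sub>v n"
  using assms unfolding pos_def_mat_def by (metis less_irrefl scalar_prod_right_zero)

lemma pos_def_mat_det_nonzero:
  assumes "pos_def_mat n S"
  shows "det S \<noteq> 0"
  using det_0_iff_vec_prod_zero_field[OF pos_def_mat_carrier[OF assms]]
    pos_def_mat_kernel[OF assms] by blast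

lemma inv_mat:
  assumes "S \<in> carrier_mat n n" "det S \<noteq> 0"
  shows "S * inv_mat S = 1\<^sub>m n" "inv_mat S * S = 1\<^sub>m n" "inv_mat S \<in> carrier_mat n n"
proof -
  obtain B where "mat_inverse S = Some B"
    using mat_inverse(1)[OF assms(1)] det_non_zero_imp_unit[OF assms] by fastforce
  then show "S * inv_mat S = 1\<^sub>m n" "inv_mat S * S = 1\<^sub>m n" "inv_mat S \<in> carrier_mat n n"
    using mat_inverse(2)[OF assms(1)] by auto
qed

text \<open>Identifies a candidate with \<open>inv_mat\<close>, which is known only through its two
  product equations; applied to the transpose and to scalar multiples.\<close>

lemma left_inverse_unique_mat:
  fixes S B C :: "real mat"
  assumes "S \<in> carrier_mat n n" "B \<in> carrier_mat n n" "C \<in> carrier_mat n n"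
    and "B * S = 1\<^sub>m n" "S * C = 1\<^sub>m n"
  shows "B = C"
  by (metis assms assoc_mult_mat left_mult_one_mat right_mult_one_mat)

text \<open>Writing v = S w with w = S^-1 v gives v \<bullet> S^-1 v = w \<bullet> S w, and w is
  nonzero because S w = v is. Symmetry follows since the transpose of the inverse is again a left
  inverse of S.\<close>

lemma
  assumes S: "pos_def_mat n S"
  shows pos_def_mat_inv: "pos_def_mat n (inv_mat S)"
    and pos_def_mat_inv_right: "S * inv_mat S = 1\<^sub>m n"
    and pos_def_mat_inv_left: "inv_mat S * S = 1\<^sub>m n"
proof -
  note Sc = pos_def_mat_carrier[OF S] and Ss = pos_def_mat_sym[OF S]
  note I = inv_mat[OF Sc pos_def_mat_det_nonzero[OF S]]
  show "S * inv_mat S = 1\<^sub>m n" "inv_mat S * S = 1\<^sub>m n" by (fact I)+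
  have "transpose_mat (inv_mat S) * S = 1\<^sub>m n"
    using transpose_mult[OF Sc I(3)] I(1) Ss by simp
  then have sym: "transpose_mat (inv_mat S) = inv_mat S"
    using left_inverse_unique_mat[OF Sc _ I(3) _ I(1)] I(3) by simp
  have "v \<bullet> (inv_mat S *\<^sub>v v) > 0" if v: "v \<in> carrier_vec n" "v \<noteq> 0\<^sub>v n" for v
  proof -
    define w where "w = inv_mat S *\<^sub>v v"
    have w: "w \<in> carrier_vec n" using I v by (simp add: w_def)
    have Sw: "S *\<^sub>v w = v"
      using assoc_mult_mat_vec[OF Sc I(3) v(1)] I(1) v by (simp add: w_def)
    have "w \<noteq> 0\<^sub>v n"
    proof
      assume "w = 0\<^sub>v n"
      then have "v = 0\<^sub>v n" using Sw Sc by (metis mult_mat_zero_vec)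
      with v show False by simp
    qed
    then have "w \<bullet> (S *\<^sub>v w) > 0" using S w by (auto simp: pos_def_mat_def)
    then show ?thesis
      using Sw comm_scalar_prod[OF v(1) w] by (simp add: w_def)
  qed
  then show "pos_def_mat n (inv_mat S)"
    using I(3) sym by (simp add: pos_def_mat_def)
qed

lemma pos_def_mat_add_psd:
  assumes "pos_def_mat n S" "psd_mat n T"
  shows "pos_def_mat n (T + S)"
proof -
  have c: "S \<in> carrier_mat n n" "T \<in> carrier_mat n n"
    using assms by (auto simp: pos_def_mat_def psd_mat_def)
  have "v \<bullet> ((T + S) *\<^sub>v v) = v \<bullet> (T *\<^sub>v v) + v \<bullet> (S *\<^sub>v v)" if "v \<in> carrier_vec n" for v
    using that c by (simp add: add_mult_distrib_mat_vec[of _ n n] scalar_prod_add_distrib[of _ n])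
  then show ?thesis
    using assms c unfolding pos_def_mat_def psd_mat_def
    by (auto simp: transpose_add[of _ n n] add_nonneg_pos)
qed

section \<open>Scalar multiples and congruences\<close>

lemma smult_mat_mult_vec:
  assumes "S \<in> carrier_mat n n" "v \<in> carrier_vec n"
  shows "(a \<cdot>\<^sub>m S) *\<^sub>v v = (a::real) \<cdot>\<^sub>v (S *\<^sub>v v)"
  using assms by (intro eq_vecI) (auto simp: row_smult)

lemma transpose_smult_mat: "transpose_mat (a \<cdot>\<^sub>m S) = a \<cdot>\<^sub>m transpose_mat S"
  by (intro eq_matI) auto

lemma quadratic_form_smult_mat:
  assumes "S \<in> carrier_mat n n" "v \<in> carrier_vec n"
  shows "v \<bullet> ((a \<cdot>\<^sub>m S) *\<^sub>v v) = (a::real) * (v \<bullet> (S *\<^sub>v v))"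
proof -
  have "S *\<^sub>v v \<in> carrier_vec n" using assms by auto
  then show ?thesis using assms by (simp add: smult_mat_mult_vec[OF assms])
qed

lemma pos_def_mat_smult:
  assumes "pos_def_mat n S" "a > 0"
  shows "pos_def_mat n (a \<cdot>\<^sub>m S)"
  using assms unfolding pos_def_mat_def
  by (auto simp: quadratic_form_smult_mat transpose_smult_mat)

lemma quadratic_form_congruence:
  fixes A S :: "real mat"
  assumes A: "A \<in> carrier_mat m n" and S: "S \<in> carrier_mat n n" and w: "w \<in> carrier_vec m"
  shows "w \<bullet> ((A * S * transpose_mat A) *\<^sub>v w) =
    (transpose_mat A *\<^sub>v w) \<bullet> (S *\<^sub>v (transpose_mat A *\<^sub>v w))"
proof -
  have At: "transpose_mat A \<in> carrier_mat n m" using A by simp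
  have "(A * S * transpose_mat A) *\<^sub>v w = A *\<^sub>v (S *\<^sub>v (transpose_mat A *\<^sub>v w))"
    using assms by (simp add: assoc_mult_mat_vec[of _ m n _ m] assoc_mult_mat_vec[of _ m n _ n])
  then show ?thesis
    using transpose_vec_mult_scalar[OF A _ w, of "S *\<^sub>v (transpose_mat A *\<^sub>v w)"] S At w
    by simp
qed

lemma psd_mat_congruence:
  assumes A: "A \<in> carrier_mat m n" and S: "psd_mat n S"
  shows "psd_mat m (A * S * transpose_mat A)"
proof -
  have Sc: "S \<in> carrier_mat n n" and Ss: "transpose_mat S = S"
    using S by (auto simp: psd_mat_def)
  have "transpose_mat (A * S * transpose_mat A) =
      transpose_mat (transpose_mat A) * transpose_mat (A * S)"
    using A Sc by (intro transpose_mult[of _ m n]) auto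
  also have "\<dots> = A * (S * transpose_mat A)"
    using transpose_mult[OF A Sc] Ss by simp
  finally have "transpose_mat (A * S * transpose_mat A) = A * (S * transpose_mat A)" .
  then have "transpose_mat (A * S * transpose_mat A) = A * S * transpose_mat A"
    using A Sc by (simp add: assoc_mult_mat[of _ m n _ n _ m])
  then show ?thesis
    using S A Sc by (auto simp: psd_mat_def quadratic_form_congruence[OF A Sc] simp del: assoc_mult_mat)
qed

section \<open>Extremal eigenvalues of symmetric matrices\<close>

text \<open>The form at s u + t v is a nonnegative quadratic polynomial in s and t. Since B may be
  degenerate, a vanishing coefficient c is treated separately.\<close>

lemma psd_cauchy_schwarz:
  assumes B: "psd_mat n B" and u: "u \<in> carrier_vec n" and v: "v \<in> carrier_vec n"
  shows "(u \<bullet> (B *\<^sub>v v))\<^sup>2 \<le> (u \<bullet> (B *\<^sub>v u)) * (v \<bullet> (B *\<^sub>v v))"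
proof -
  have Bc: "B \<in> carrier_mat n n" and Bs: "transpose_mat B = B"
    and pos: "\<And>w. w \<in> carrier_vec n \<Longrightarrow> w \<bullet> (B *\<^sub>v w) \<ge> 0"
    using B by (auto simp: psd_mat_def)
  define a b c where "a = u \<bullet> (B *\<^sub>v u)" and "b = u \<bullet> (B *\<^sub>v v)" and "c = v \<bullet> (B *\<^sub>v v)"
  have Bv: "B *\<^sub>v v \<in> carrier_vec n" using Bc v by auto
  have *: "0 \<le> s\<^sup>2 * a + 2 * (s * t) * b + t\<^sup>2 * c" for s t
  proof -
    have "0 \<le> (s \<cdot>\<^sub>v u + t \<cdot>\<^sub>v v) \<bullet> (B *\<^sub>v (s \<cdot>\<^sub>v u + t \<cdot>\<^sub>v v))"
      using u v by (intro pos) auto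
    also have "\<dots> = s\<^sup>2 * a + 2 * (s * t) * b + t\<^sup>2 * c"
      using u v Bv unfolding a_def b_def c_def
      by (subst quadratic_form_add[OF Bc Bs])
         (auto simp: quadratic_form_smult[OF Bc] mult_mat_vec[OF Bc v] power2_eq_square)
    finally show ?thesis .
  qed
  have "c \<ge> 0" using pos v by (simp add: c_def)
  have "b\<^sup>2 \<le> a * c"
  proof (cases "c = 0")
    case True
    have "b = 0"
    proof (rule ccontr)
      assume "b \<noteq> 0"
      \<comment> \<open>With c = 0, the point s = 1, t = -(a + 1) / (2 b) makes the polynomial equal
        to -1.\<close>
      then show False using *[of 1 "- (a + 1) / (2 * b)"] True by (simp add: field_simps)
    qed
    then show ?thesis using True by simp
  next
    case False
    then have "c > 0" using \<open>c \<ge> 0\<close> by simp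
    \<comment> \<open>For s = c the minimum over t is attained at t = -b.\<close>
    have "0 \<le> c * (a * c - b\<^sup>2)"
      using *[of c "- b"] by (simp add: algebra_simps power2_eq_square)
    then show ?thesis using \<open>c > 0\<close> by (simp add: zero_le_mult_iff)
  qed
  then show ?thesis by (simp add: a_def b_def c_def)
qed

lemma quadratic_form_sum:
  fixes P :: "real mat"
  assumes "P \<in> carrier_mat n n" "v \<in> carrier_vec n"
  shows "v \<bullet> (P *\<^sub>v v) = (\<Sum>i<n. \<Sum>j<n. P $$ (i, j) * (v $ i * v $ j))"
  using assms by (auto simp: scalar_prod_def sum_distrib_left lessThan_atLeast0 intro!: sum.cong)

lemma quadratic_form_bounded:
  fixes C :: "real mat"
  assumes C: "C \<in> carrier_mat n n"
  obtains K where "K > 0" "\<And>v. v \<in> carrier_vec n \<Longrightarrow> \<bar>v \<bullet> (C *\<^sub>v v)\<bar> \<le> K * (v \<bullet> v)"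
proof
  \<comment> \<open>The summand 1 keeps the constant positive even for C = 0, so that its reciprocal
    can serve as a spectral gap below.\<close>
  let ?K = "(\<Sum>i<n. \<Sum>j<n. \<bar>C $$ (i, j)\<bar>) + 1"
  show "?K > 0" by (intro add_nonneg_pos sum_nonneg) auto
  fix v :: "real vec" assume v: "v \<in> carrier_vec n"
  have sq: "(v $ i)\<^sup>2 \<le> v \<bullet> v" if "i < n" for i
    unfolding scalar_prod_def power2_eq_square using that v by (intro member_le_sum) auto
  have "v \<bullet> (C *\<^sub>v v) = (\<Sum>i<n. \<Sum>j<n. C $$ (i, j) * (v $ i * v $ j))"
    by (rule quadratic_form_sum[OF C v])
  also have "\<bar>\<dots>\<bar> \<le> (\<Sum>i<n. \<Sum>j<n. \<bar>C $$ (i, j)\<bar> * (v \<bullet> v))"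
  proof (intro order_trans[OF sum_abs] sum_mono)
    fix i j assume ij: "i \<in> {..<n}" "j \<in> {..<n}"
    have "2 * \<bar>v $ i * v $ j\<bar> \<le> (v $ i)\<^sup>2 + (v $ j)\<^sup>2"
      using sum_squares_bound[of "\<bar>v $ i\<bar>" "\<bar>v $ j\<bar>"] by (simp add: abs_mult)
    then have "\<bar>v $ i * v $ j\<bar> \<le> v \<bullet> v" using sq ij by (smt (verit) lessThan_iff)
    then show "\<bar>C $$ (i, j) * (v $ i * v $ j)\<bar> \<le> \<bar>C $$ (i, j)\<bar> * (v \<bullet> v)"
      by (simp add: abs_mult[of "C $$ (i, j)"] mult_left_mono)
  qed
  also have "\<dots> \<le> ?K * (v \<bullet> v)"
    using scalar_prod_self_nonneg[of v] by (simp add: distrib_right flip: sum_distrib_right)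
  finally show "\<bar>v \<bullet> (C *\<^sub>v v)\<bar> \<le> ?K * (v \<bullet> v)" .
qed

text \<open>The supremum \<open>k\<close> of the Rayleigh quotient is an eigenvalue: otherwise \<open>B = k I - S\<close> would be
  invertible, and the Cauchy-Schwarz inequality for \<open>B\<close>, applied to \<open>v\<close> and \<open>B\<^sup>-\<^sup>1 v\<close>, would bound
  \<open>B\<close> away from zero.\<close>

lemma rayleigh_max_eigenvalue:
  fixes S :: "real mat"
  assumes S: "S \<in> carrier_mat n n" "transpose_mat S = S" and n: "n \<ge> 1"
  obtains k where "eigenvalue S k" "\<And>v. v \<in> carrier_vec n \<Longrightarrow> v \<bullet> (S *\<^sub>v v) \<le> k * (v \<bullet> v)"
proof -
  define Q where "Q = (\<lambda>v. (v \<bullet> (S *\<^sub>v v)) / (v \<bullet> v)) ` {v \<in> carrier_vec n. v \<noteq> 0\<^sub>v n}"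
  define k where "k = Sup Q"
  define B where "B = k \<cdot>\<^sub>m 1\<^sub>m n - S"
  obtain K where K: "\<And>v. v \<in> carrier_vec n \<Longrightarrow> \<bar>v \<bullet> (S *\<^sub>v v)\<bar> \<le> K * (v \<bullet> v)"
    using quadratic_form_bounded[OF S(1)] by metis
  have bdd: "bdd_above Q"
  proof (rule bdd_aboveI[of _ K])
    fix x assume "x \<in> Q"
    then obtain v where v: "v \<in> carrier_vec n" "v \<noteq> 0\<^sub>v n" "x = (v \<bullet> (S *\<^sub>v v)) / (v \<bullet> v)"
      by (auto simp: Q_def)
    have "v \<bullet> (S *\<^sub>v v) \<le> K * (v \<bullet> v)" using K[OF v(1)] by (simp add: abs_le_iff)
    then show "x \<le> K" using scalar_prod_self_pos[OF v(1,2)] v(3) by (simp add: divide_le_eq)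
  qed
  \<comment> \<open>Here n \<ge> 1 enters: in dimension 0 there is no nonzero vector, so
    \<open>Q\<close> would be empty.\<close>
  have "unit_vec n 0 $ 0 \<noteq> (0\<^sub>v n :: real vec) $ 0" using n by simp
  then have "unit_vec n 0 \<noteq> (0\<^sub>v n :: real vec)" by metis
  then have ne: "Q \<noteq> {}" unfolding Q_def by (metis (mono_tags, lifting) empty_iff image_is_empty mem_Collect_eq unit_vec_carrier)
  have le: "v \<bullet> (S *\<^sub>v v) \<le> k * (v \<bullet> v)" if v: "v \<in> carrier_vec n" for v
  proof (cases "v = 0\<^sub>v n")
    case True then show ?thesis using S v by simp
  next
    case False
    have "(v \<bullet> (S *\<^sub>v v)) / (v \<bullet> v) \<le> k"
      unfolding k_def using False v by (intro cSup_upper bdd) (auto simp: Q_def)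
    then show ?thesis using scalar_prod_self_pos[OF v False] by (simp add: divide_le_eq)
  qed
  have Bc: "B \<in> carrier_mat n n" using S by (simp add: B_def minus_carrier_mat)
  have Bv: "B *\<^sub>v v = k \<cdot>\<^sub>v v - S *\<^sub>v v" if "v \<in> carrier_vec n" for v
    using that S(1) by (simp add: B_def minus_mult_distrib_mat_vec[of _ n n] smult_mat_mult_vec[of _ n])
  have Bq: "v \<bullet> (B *\<^sub>v v) = k * (v \<bullet> v) - v \<bullet> (S *\<^sub>v v)" if v: "v \<in> carrier_vec n" for v
  proof -
    have "S *\<^sub>v v \<in> carrier_vec n" using S v by auto
    then show ?thesis using v by (simp add: Bv[OF v] scalar_prod_minus_distrib[of _ n])
  qed
  have "transpose_mat B = B"
  proof (intro eq_matI)
    fix i j assume "i < dim_row B" "j < dim_col B"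
    moreover have "S $$ (j, i) = S $$ (i, j)" if "i < n" "j < n" for i j
      using S that by (metis carrier_matD(1,2) index_transpose_mat(1))
    ultimately show "transpose_mat B $$ (i, j) = B $$ (i, j)"
      using S by (auto simp: B_def)
  qed (use Bc in auto)
  then have psd: "psd_mat n B"
    using Bc Bq le by (auto simp: psd_mat_def)
  have "det B = 0"
  proof (rule ccontr)
    assume "det B \<noteq> 0"
    note C = inv_mat[OF Bc this]
    obtain L where L: "L > 0" "\<And>v. v \<in> carrier_vec n \<Longrightarrow> \<bar>v \<bullet> (inv_mat B *\<^sub>v v)\<bar> \<le> L * (v \<bullet> v)"
      using quadratic_form_bounded[OF C(3)] by metis
    \<comment> \<open>For w = B^-1 v one has v \<bullet> B w = |v|^2 and w \<bullet> B w = w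
      \<bullet> v \<le> L |v|^2, so Cauchy-Schwarz gives |v|^2 \<le> L (v \<bullet> B v). As v
      \<bullet> B v = (k - x) |v|^2, every Rayleigh quotient x stays 1 / L below the supremum
      k.\<close>
    have "x \<le> k - 1 / L" if "x \<in> Q" for x
    proof -
      obtain v where v: "v \<in> carrier_vec n" "v \<noteq> 0\<^sub>v n" "x = (v \<bullet> (S *\<^sub>v v)) / (v \<bullet> v)"
        using \<open>x \<in> Q\<close> by (auto simp: Q_def)
      define w where "w = inv_mat B *\<^sub>v v"
      have w: "w \<in> carrier_vec n" using C v by (simp add: w_def)
      have Bw: "B *\<^sub>v w = v"
        using assoc_mult_mat_vec[OF Bc C(3) v(1)] C(1) v by (simp add: w_def)
      have pos: "v \<bullet> v > 0" by (rule scalar_prod_self_pos[OF v(1,2)])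
      have Bnn: "v \<bullet> (B *\<^sub>v v) \<ge> 0" using psd v by (simp add: psd_mat_def)
      have "w \<bullet> v \<le> L * (v \<bullet> v)"
        using L(2)[OF v(1)] comm_scalar_prod[OF v(1) w] by (simp add: w_def abs_le_iff)
      then have "(v \<bullet> v)\<^sup>2 \<le> (v \<bullet> (B *\<^sub>v v)) * (L * (v \<bullet> v))"
        using psd_cauchy_schwarz[OF psd v(1) w] Bw mult_left_mono[OF _ Bnn] by fastforce
      then have "(v \<bullet> v) * (v \<bullet> v) \<le> (L * (v \<bullet> (B *\<^sub>v v))) * (v \<bullet> v)"
        by (simp add: power2_eq_square algebra_simps)
      then have "v \<bullet> v \<le> L * (v \<bullet> (B *\<^sub>v v))" using pos by simp
      then have "v \<bullet> v \<le> L * (k * (v \<bullet> v) - v \<bullet> (S *\<^sub>v v))" using Bq[OF v(1)] by simp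
      moreover have "v \<bullet> (S *\<^sub>v v) = x * (v \<bullet> v)" using v(3) pos by simp
      ultimately have "(v \<bullet> v) * 1 \<le> (v \<bullet> v) * (L * (k - x))"
        by (simp add: algebra_simps)
      then have "1 \<le> L * (k - x)" using pos by (simp only: mult_le_cancel_left_pos)
      then show ?thesis using L(1) by (simp add: field_simps)
    qed
    then have "k \<le> k - 1 / L" unfolding k_def using ne by (intro cSup_least) auto
    then show False using L(1) by simp
  qed
  then obtain v where v: "v \<in> carrier_vec n" "v \<noteq> 0\<^sub>v n" "B *\<^sub>v v = 0\<^sub>v n"
    using det_0_iff_vec_prod_zero_field[OF Bc] by blast
  have "S *\<^sub>v v = k \<cdot>\<^sub>v v"
  proof (intro eq_vecI)
    fix i assume "i < dim_vec (k \<cdot>\<^sub>v v)"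
    then have i: "i < n" using v by simp
    have "k \<cdot>\<^sub>v v - S *\<^sub>v v = 0\<^sub>v n" using Bv[OF v(1)] v(3) by metis
    from arg_cong[OF this, of "\<lambda>w. w $ i"]
    show "(S *\<^sub>v v) $ i = (k \<cdot>\<^sub>v v) $ i" using i S v(1) by simp
  qed (use S v in auto)
  then have "eigenvalue S k"
    using v S unfolding eigenvalue_def eigenvector_def by auto
  with le show ?thesis using that by blast
qed

lemma eigenvalue_rayleigh:
  fixes S :: "real mat"
  assumes "S \<in> carrier_mat n n" "eigenvalue S l"
  obtains v where "v \<in> carrier_vec n" "v \<bullet> v > 0" "v \<bullet> (S *\<^sub>v v) = l * (v \<bullet> v)"
proof -
  obtain v where "v \<in> carrier_vec n" "v \<noteq> 0\<^sub>v n" "S *\<^sub>v v = l \<cdot>\<^sub>v v"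
    using assms by (auto simp: eigenvalue_def eigenvector_def)
  then show ?thesis using scalar_prod_self_pos[of v n] that by simp
qed

text \<open>\<open>Max\<close> and \<open>Min\<close> in the definitions of the extremal eigenvalues
  are meaningful only on finite sets. Eigenvalues are roots of the characteristic polynomial, which
  is monic and hence nonzero.\<close>

lemma finite_eigenvalues:
  fixes S :: "real mat"
  assumes "S \<in> carrier_mat n n"
  shows "finite {k. eigenvalue S k}"
proof -
  have "char_poly S \<noteq> 0" using degree_monic_char_poly[OF assms] by auto
  then show ?thesis using poly_roots_finite by (simp add: eigenvalue_root_char_poly[OF assms])
qed

text \<open>The Rayleigh bound is itself an eigenvalue and, tested on eigenvectors, dominates every
  other one, so it is the \<open>Max\<close> in the definition.\<close>

lemma
  fixes S :: "real mat"
  assumes S: "S \<in> carrier_mat n n" "transpose_mat S = S" and n: "n \<ge> 1"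
  shows eigenvalue_max_eigenvalue: "eigenvalue S (max_eigenvalue S)"
    and quadratic_form_le_max_eigenvalue:
      "v \<in> carrier_vec n \<Longrightarrow> v \<bullet> (S *\<^sub>v v) \<le> max_eigenvalue S * (v \<bullet> v)"
proof -
  obtain k where k: "eigenvalue S k" "\<And>v. v \<in> carrier_vec n \<Longrightarrow> v \<bullet> (S *\<^sub>v v) \<le> k * (v \<bullet> v)"
    using rayleigh_max_eigenvalue[OF assms] by blast
  have "l \<le> k" if "eigenvalue S l" for l
    using eigenvalue_rayleigh[OF S(1) that] k(2) by (metis mult_le_cancel_right_pos)
  then have "max_eigenvalue S = k"
    unfolding max_eigenvalue_def using k(1) finite_eigenvalues[OF S(1)] by (intro Max_eqI) auto
  with k show "eigenvalue S (max_eigenvalue S)"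
    "v \<in> carrier_vec n \<Longrightarrow> v \<bullet> (S *\<^sub>v v) \<le> max_eigenvalue S * (v \<bullet> v)" by auto
qed

lemma eigenvalue_uminus:
  fixes S :: "real mat"
  assumes "S \<in> carrier_mat n n" "eigenvalue (- S) k"
  shows "eigenvalue S (- k)"
proof -
  obtain v where v: "v \<in> carrier_vec n" "v \<noteq> 0\<^sub>v n" "(- S) *\<^sub>v v = k \<cdot>\<^sub>v v"
    using assms by (auto simp: eigenvalue_def eigenvector_def)
  have "S *\<^sub>v v = - k \<cdot>\<^sub>v v"
  proof (intro eq_vecI)
    fix i assume "i < dim_vec (- k \<cdot>\<^sub>v v)"
    then have i: "i < n" using v by simp
    have "- (S *\<^sub>v v) = k \<cdot>\<^sub>v v" using v assms(1) by simp
    from arg_cong[OF this, of "\<lambda>w. w $ i"]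
    show "(S *\<^sub>v v) $ i = (- k \<cdot>\<^sub>v v) $ i" using i assms(1) v(1) by simp
  qed (use assms(1) v in auto)
  then show ?thesis
    using v assms(1) unfolding eigenvalue_def eigenvector_def by auto
qed

text \<open>The Rayleigh argument applied to - S: minus the bound obtained there is an eigenvalue of
  S and lies below all others.\<close>

lemma
  fixes S :: "real mat"
  assumes S: "S \<in> carrier_mat n n" "transpose_mat S = S" and n: "n \<ge> 1"
  shows eigenvalue_min_eigenvalue: "eigenvalue S (min_eigenvalue S)"
    and quadratic_form_ge_min_eigenvalue:
      "v \<in> carrier_vec n \<Longrightarrow> min_eigenvalue S * (v \<bullet> v) \<le> v \<bullet> (S *\<^sub>v v)"
proof -
  have "transpose_mat (- S) = - S" using S(2) by (metis transpose_uminus)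
  then obtain k where k: "eigenvalue (- S) k"
      "\<And>v. v \<in> carrier_vec n \<Longrightarrow> v \<bullet> ((- S) *\<^sub>v v) \<le> k * (v \<bullet> v)"
    using rayleigh_max_eigenvalue[of "- S" n] S(1) n by (metis uminus_carrier_mat)
  have k': "- k * (v \<bullet> v) \<le> v \<bullet> (S *\<^sub>v v)" if "v \<in> carrier_vec n" for v
    using k(2)[OF that] that S(1) by simp
  have "- k \<le> l" if "eigenvalue S l" for l
    using eigenvalue_rayleigh[OF S(1) that] k' by (metis mult_le_cancel_right_pos)
  then have "min_eigenvalue S = - k"
    unfolding min_eigenvalue_def
    using eigenvalue_uminus[OF S(1) k(1)] finite_eigenvalues[OF S(1)] by (intro Min_eqI) auto
  with k' eigenvalue_uminus[OF S(1) k(1)] show "eigenvalue S (min_eigenvalue S)"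
    "v \<in> carrier_vec n \<Longrightarrow> min_eigenvalue S * (v \<bullet> v) \<le> v \<bullet> (S *\<^sub>v v)" by auto
qed

section \<open>Lebesgue measure on coordinate vectors\<close>

interpretation lborel_family: product_sigma_finite "\<lambda>_::nat. lborel :: real measure"
  by unfold_locales

text \<open>Makes the transport along \<open>vec n\<close> lossless: the product space consists of
  extensional functions, all \<open>undefined\<close> outside {..<n}, so their first n values
  determine them.\<close>

lemma inj_on_vec: "inj_on (vec n) (space (\<Pi>\<^sub>M i\<in>{..<n}. (lborel :: real measure)))"
proof (rule inj_onI)
  fix f g :: "nat \<Rightarrow> real"
  assume f: "f \<in> space (\<Pi>\<^sub>M i\<in>{..<n}. lborel)" and g: "g \<in> space (\<Pi>\<^sub>M i\<in>{..<n}. lborel)"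
    and eq: "vec n f = vec n g"
  show "f = g"
  proof
    fix i
    show "f i = g i"
    proof (cases "i < n")
      case True
      then show ?thesis using arg_cong[OF eq, of "\<lambda>v. v $ i"] by simp
    next
      case False
      then have "f i = undefined" "g i = undefined"
        using f g by (auto simp: space_PiM PiE_iff extensional_def)
      then show ?thesis by simp
    qed
  qed
qed

section \<open>Measurability of vector-valued maps\<close>

lemma measurable_vec: "vec n \<in> measurable (\<Pi>\<^sub>M i\<in>{..<n}. (lborel :: real measure)) (lborel_vec n)"
  unfolding lborel_vec_def by (rule measurable_embed_measure2'[OF inj_on_vec])

lemma measurable_vec_index:
  assumes "i < n"
  shows "(\<lambda>v. v $ i) \<in> borel_measurable (lborel_vec n)"
  unfolding lborel_vec_def
proof (rule measurable_embed_measure1)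
  have "(\<lambda>f. f i) \<in> borel_measurable (\<Pi>\<^sub>M i\<in>{..<n}. (lborel :: real measure))"
    using assms measurable_component_singleton[of i "{..<n}" "\<lambda>_. lborel :: real measure"]
    by simp
  then show "(\<lambda>f. vec n f $ i) \<in> borel_measurable (\<Pi>\<^sub>M i\<in>{..<n}. (lborel :: real measure))"
    using assms by simp
qed

text \<open>Any such f is \<open>vec n\<close> after the tuple of its coordinates, and a tuple is
  measurable for the product sigma-algebra as soon as its components are.\<close>

lemma measurable_lborel_vecI:
  assumes c: "\<And>x. x \<in> space M \<Longrightarrow> f x \<in> carrier_vec n"
    and m: "\<And>i. i < n \<Longrightarrow> (\<lambda>x. f x $ i) \<in> borel_measurable M"
  shows "f \<in> measurable M (lborel_vec n)"
proof -
  have "(\<lambda>x. \<lambda>i\<in>{..<n}. f x $ i) \<in> measurable M (\<Pi>\<^sub>M i\<in>{..<n}. (lborel :: real measure))"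
    using m by (intro measurable_restrict) simp
  from measurable_compose[OF this measurable_vec]
  have "(\<lambda>x. vec n (\<lambda>i\<in>{..<n}. f x $ i)) \<in> measurable M (lborel_vec n)" .
  also have "?this \<longleftrightarrow> ?thesis"
    by (intro measurable_cong eq_vecI) (auto simp: carrier_vecD[OF c])
  finally show ?thesis .
qed

lemma measurable_lborel_vec_index:
  assumes "f \<in> measurable M (lborel_vec n)" "i < n"
  shows "(\<lambda>x. f x $ i) \<in> borel_measurable M"
  by (rule measurable_compose[OF assms(1) measurable_vec_index[OF assms(2)]])

lemma lborel_vec_carrier:
  "f \<in> measurable M (lborel_vec n) \<Longrightarrow> x \<in> space M \<Longrightarrow> f x \<in> carrier_vec n"
  using measurable_space[of f M "lborel_vec n"] by (simp add: space_lborel_vec)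

lemma measurable_vec_add:
  assumes "f \<in> measurable M (lborel_vec n)" "g \<in> measurable M (lborel_vec n)"
  shows "(\<lambda>x. f x + g x) \<in> measurable M (lborel_vec n)"
proof (rule measurable_lborel_vecI)
  fix i assume i: "i < n"
  have "(\<lambda>x. f x $ i + g x $ i) \<in> borel_measurable M"
    using assms i by (intro borel_measurable_add measurable_lborel_vec_index)
  also have "?this \<longleftrightarrow> (\<lambda>x. (f x + g x) $ i) \<in> borel_measurable M"
    using lborel_vec_carrier[OF assms(1)] lborel_vec_carrier[OF assms(2)] i
    by (intro measurable_cong) (metis carrier_vecD index_add_vec(1))
  finally show "(\<lambda>x. (f x + g x) $ i) \<in> borel_measurable M" .
qed (rule add_carrier_vec[OF lborel_vec_carrier[OF assms(1)] lborel_vec_carrier[OF assms(2)]])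

lemma measurable_vec_minus:
  assumes "f \<in> measurable M (lborel_vec n)" "g \<in> measurable M (lborel_vec n)"
  shows "(\<lambda>x. f x - g x) \<in> measurable M (lborel_vec n)"
proof (rule measurable_lborel_vecI)
  fix i assume i: "i < n"
  have "(\<lambda>x. f x $ i - g x $ i) \<in> borel_measurable M"
    using assms i by (intro borel_measurable_diff measurable_lborel_vec_index)
  also have "?this \<longleftrightarrow> (\<lambda>x. (f x - g x) $ i) \<in> borel_measurable M"
    using lborel_vec_carrier[OF assms(1)] lborel_vec_carrier[OF assms(2)] i
    by (intro measurable_cong) (metis carrier_vecD index_minus_vec(1))
  finally show "(\<lambda>x. (f x - g x) $ i) \<in> borel_measurable M" .
qed (rule minus_carrier_vec[OF lborel_vec_carrier[OF assms(1)] lborel_vec_carrier[OF assms(2)]])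

lemma measurable_scalar_prod:
  assumes "f \<in> measurable M (lborel_vec n)" "g \<in> measurable M (lborel_vec n)"
  shows "(\<lambda>x. f x \<bullet> g x) \<in> borel_measurable M"
proof -
  have "(\<lambda>x. \<Sum>i<n. f x $ i * g x $ i) \<in> borel_measurable M"
    using assms by (intro borel_measurable_sum borel_measurable_times measurable_lborel_vec_index) auto
  also have "?this \<longleftrightarrow> ?thesis"
    by (intro measurable_cong)
       (simp add: scalar_prod_def lessThan_atLeast0 carrier_vecD[OF lborel_vec_carrier[OF assms(2)]])
  finally show ?thesis .
qed

lemma measurable_mult_mat_vec:
  assumes A: "A \<in> carrier_mat m n" and f: "f \<in> measurable M (lborel_vec n)"
  shows "(\<lambda>x. A *\<^sub>v f x) \<in> measurable M (lborel_vec m)"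
proof (rule measurable_lborel_vecI)
  fix i assume i: "i < m"
  have r: "(\<lambda>x. row A i) \<in> measurable M (lborel_vec n)"
    using A i by (intro measurable_const) (simp add: space_lborel_vec)
  show "(\<lambda>x. (A *\<^sub>v f x) $ i) \<in> borel_measurable M"
    using measurable_scalar_prod[OF r f] A i by simp
qed (use A lborel_vec_carrier[OF f] in auto)

lemma measurable_quadratic_form:
  assumes "P \<in> carrier_mat n n" "f \<in> measurable M (lborel_vec n)"
  shows "(\<lambda>x. f x \<bullet> (P *\<^sub>v f x)) \<in> borel_measurable M"
  by (intro measurable_scalar_prod[of _ _ n] measurable_mult_mat_vec[of _ n n] assms)

lemma measurable_lborel_vec_const:
  "c \<in> carrier_vec n \<Longrightarrow> (\<lambda>x. c) \<in> measurable M (lborel_vec n)"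
  by (intro measurable_const) (simp add: space_lborel_vec)

section \<open>Integration over coordinate vectors: sigma-finiteness, translation, splitting off a
  coordinate\<close>

lemma nn_integral_lborel_vec:
  assumes "g \<in> borel_measurable (lborel_vec n)"
  shows "(\<integral>\<^sup>+v. g v \<partial>lborel_vec n) = (\<integral>\<^sup>+f. g (vec n f) \<partial>(\<Pi>\<^sub>M i\<in>{..<n}. (lborel :: real measure)))"
  using assms unfolding lborel_vec_def by (intro nn_integral_embed_measure'[OF inj_on_vec])

text \<open>Required for the exchanges of integrals below. A countable cover of the product space by
  sets of finite measure is carried over by taking images under the injective map
  \<open>vec n\<close>.\<close>

lemma sigma_finite_lborel_vec: "sigma_finite_measure (lborel_vec n)"
proof -
  let ?P = "\<Pi>\<^sub>M i\<in>{..<n}. (lborel :: real measure)"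
  interpret P: sigma_finite_measure ?P
    by (rule lborel_family.sigma_finite) simp
  obtain A where A: "countable A" "A \<subseteq> sets ?P" "\<Union>A = space ?P" "\<forall>a\<in>A. emeasure ?P a \<noteq> \<infinity>"
    using P.sigma_finite_countable by blast
  show ?thesis
  proof
    have "\<Union>((`) (vec n) ` A) = space (lborel_vec n)"
      unfolding lborel_vec_def space_embed_measure A(3)[symmetric] by blast
    moreover have "(`) (vec n) ` A \<subseteq> sets (lborel_vec n)"
      using A(2) unfolding lborel_vec_def by (auto intro: in_sets_embed_measure)
    moreover have "\<forall>a\<in>(`) (vec n) ` A. emeasure (lborel_vec n) a \<noteq> \<infinity>"
      using A(2,4) unfolding lborel_vec_def
      by (auto simp: emeasure_embed_measure_image'[OF inj_on_vec] subset_eq)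
    ultimately show "\<exists>B. countable B \<and> B \<subseteq> sets (lborel_vec n) \<and> \<Union>B = space (lborel_vec n) \<and>
        (\<forall>a\<in>B. emeasure (lborel_vec n) a \<noteq> \<infinity>)"
      using A(1) by (intro exI[of _ "(`) (vec n) ` A"]) auto
  qed
qed

text \<open>A product measure is determined by its values on boxes, and the preimage of a box under
  a translation is the box with translated sides, so the one-dimensional invariance applies to each
  side.\<close>

lemma lborel_PiM_translation:
  fixes c :: "nat \<Rightarrow> real" and n :: nat
  defines "P \<equiv> \<Pi>\<^sub>M i\<in>{..<n}. (lborel :: real measure)"
  shows "distr P P (\<lambda>f. \<lambda>i\<in>{..<n}. f i - c i) = P"
proof -
  let ?T = "\<lambda>f. \<lambda>i\<in>{..<n}. f i - c i"
  have comp: "(\<lambda>f. f i) \<in> borel_measurable P" if "i < n" for i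
    using that measurable_component_singleton[of i "{..<n}" "\<lambda>_. lborel :: real measure"]
    by (simp add: P_def)
  have T: "?T \<in> measurable P P"
    unfolding P_def using comp[unfolded P_def] by (intro measurable_restrict) simp
  have "distr P P ?T = Pi\<^sub>M {..<n} (\<lambda>_. lborel)"
  proof (rule lborel_family.PiM_eqI)
    fix A :: "nat \<Rightarrow> real set" assume A: "\<And>i. i \<in> {..<n} \<Longrightarrow> A i \<in> sets lborel"
    have B: "(\<lambda>x. x + - c i) -` A i \<in> sets lborel" if "i \<in> {..<n}" for i
      using measurable_sets[of "\<lambda>x. x + - c i" borel borel "A i"] A[OF that] by simp
    have "emeasure (distr P P ?T) (Pi\<^sub>E {..<n} A) = emeasure P (?T -` Pi\<^sub>E {..<n} A \<inter> space P)"
      using A by (intro emeasure_distr T) (auto simp: P_def intro!: sets_PiM_I_finite)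
    also have "?T -` Pi\<^sub>E {..<n} A \<inter> space P = Pi\<^sub>E {..<n} (\<lambda>i. (\<lambda>x. x + - c i) -` A i)"
      by (auto simp: P_def space_PiM PiE_iff)
    also have "emeasure P \<dots> = (\<Prod>i<n. emeasure lborel ((\<lambda>x. x + - c i) -` A i))"
      unfolding P_def using B by (intro lborel_family.emeasure_PiM) auto
    also have "\<dots> = (\<Prod>i<n. emeasure lborel (A i))"
    proof (intro prod.cong refl)
      fix i assume i: "i \<in> {..<n}"
      have "emeasure lborel (A i) = emeasure (distr lborel borel ((+) (- c i))) (A i)"
        by (simp add: lborel_distr_plus)
      also have "\<dots> = emeasure lborel ((+) (- c i) -` A i)"
        using A[OF i] by (subst emeasure_distr) auto
      finally show "emeasure lborel ((\<lambda>x. x + - c i) -` A i) = emeasure lborel (A i)"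
        by (simp add: vimage_def add.commute)
    qed
    finally show "emeasure (distr P P ?T) (Pi\<^sub>E {..<n} A) = (\<Prod>i<n. emeasure lborel (A i))" .
  qed (auto simp: P_def)
  then show ?thesis by (simp add: P_def)
qed

lemma nn_integral_lborel_vec_translate_minus:
  assumes g: "g \<in> borel_measurable (lborel_vec n)" and w: "w \<in> carrier_vec n"
  shows "(\<integral>\<^sup>+v. g (v - w) \<partial>lborel_vec n) = (\<integral>\<^sup>+v. g v \<partial>lborel_vec n)"
proof -
  let ?P = "\<Pi>\<^sub>M i\<in>{..<n}. (lborel :: real measure)"
  let ?T = "\<lambda>f. \<lambda>i\<in>{..<n}. f i - w $ i"
  have gw: "(\<lambda>v. g (v - w)) \<in> borel_measurable (lborel_vec n)"
    by (rule measurable_compose[OF measurable_vec_minus g])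
       (use w in \<open>auto simp: space_lborel_vec\<close>)
  have gv: "(\<lambda>f. g (vec n f)) \<in> borel_measurable ?P"
    by (rule measurable_compose[OF measurable_vec g])
  have comp: "(\<lambda>f. f i) \<in> borel_measurable ?P" if "i < n" for i
    using that measurable_component_singleton[of i "{..<n}" "\<lambda>_. lborel :: real measure"]
    by simp
  have T: "?T \<in> measurable ?P ?P"
    using comp by (intro measurable_restrict) simp
  have "(\<integral>\<^sup>+v. g v \<partial>lborel_vec n) = (\<integral>\<^sup>+f. g (vec n f) \<partial>distr ?P ?P ?T)"
    by (simp only: nn_integral_lborel_vec[OF g] lborel_PiM_translation)
  also have "\<dots> = (\<integral>\<^sup>+f. g (vec n (?T f)) \<partial>?P)"
    by (rule nn_integral_distr[where f = "\<lambda>f. g (vec n f)"]) (fact T, simp only: measurable_distr_eq1 gv)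
  also have "\<dots> = (\<integral>\<^sup>+f. g (vec n f - w) \<partial>?P)"
    using w by (intro nn_integral_cong arg_cong[of _ _ g] eq_vecI) auto
  also have "\<dots> = (\<integral>\<^sup>+v. g (v - w) \<partial>lborel_vec n)"
    by (simp only: nn_integral_lborel_vec[OF gw])
  finally show ?thesis by simp
qed

text \<open>The index set {..<Suc n} is {..<n} with n inserted, so the coordinate split off is the
  last one; \<open>vec 1\<close> turns it into a vector of length 1 that is appended.\<close>

lemma nn_integral_lborel_vec_Suc:
  assumes g: "g \<in> borel_measurable (lborel_vec (Suc n))"
  shows "(\<integral>\<^sup>+v. g v \<partial>lborel_vec (Suc n)) =
    (\<integral>\<^sup>+w. (\<integral>\<^sup>+t. g (w @\<^sub>v vec 1 (\<lambda>_. t)) \<partial>lborel) \<partial>lborel_vec n)"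
proof -
  have "(\<lambda>p. fst p @\<^sub>v vec 1 (\<lambda>_. snd p)) \<in> measurable (lborel_vec n \<Otimes>\<^sub>M lborel) (lborel_vec (Suc n))"
  proof (rule measurable_lborel_vecI)
    fix i assume i: "i < Suc n"
    show "(\<lambda>p. (fst p @\<^sub>v vec 1 (\<lambda>_. snd p)) $ i) \<in> borel_measurable (lborel_vec n \<Otimes>\<^sub>M lborel)"
    proof (cases "i < n")
      case True
      have "(\<lambda>p. fst p $ i) \<in> borel_measurable (lborel_vec n \<Otimes>\<^sub>M (lborel :: real measure))"
        using True by (intro measurable_lborel_vec_index[of _ _ n]) auto
      also have "?this \<longleftrightarrow> ?thesis"
        using True by (intro measurable_cong) (auto simp: space_pair_measure space_lborel_vec)
      finally show ?thesis .
    next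
      case False
      have "(\<lambda>p. snd p) \<in> borel_measurable (lborel_vec n \<Otimes>\<^sub>M (lborel :: real measure))"
        by measurable
      also have "?this \<longleftrightarrow> ?thesis"
        using False i by (intro measurable_cong) (auto simp: space_pair_measure space_lborel_vec)
      finally show ?thesis .
    qed
  next
    fix p :: "real vec \<times> real"
    assume "p \<in> space (lborel_vec n \<Otimes>\<^sub>M lborel)"
    then have "fst p \<in> carrier_vec n" by (simp add: space_pair_measure space_lborel_vec mem_Times_iff)
    then show "fst p @\<^sub>v vec 1 (\<lambda>_. snd p) \<in> carrier_vec (Suc n)" by (intro carrier_vecI) simp
  qed
  from measurable_compose[OF this g]
  have joint: "(\<lambda>(w, t). g (w @\<^sub>v vec 1 (\<lambda>_. t))) \<in> borel_measurable (lborel_vec n \<Otimes>\<^sub>M lborel)"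
    by (simp add: split_beta)
  have inner: "(\<lambda>w. \<integral>\<^sup>+t. g (w @\<^sub>v vec 1 (\<lambda>_. t)) \<partial>lborel) \<in> borel_measurable (lborel_vec n)"
    using lborel.borel_measurable_nn_integral[OF joint] .
  have gv: "(\<lambda>f. g (vec (Suc n) f)) \<in> borel_measurable (\<Pi>\<^sub>M i\<in>insert n {..<n}. (lborel :: real measure))"
    using measurable_compose[OF measurable_vec g] by (simp add: lessThan_Suc)
  have app: "vec (Suc n) (f(n := t)) = vec n f @\<^sub>v vec 1 (\<lambda>_. t)" for f and t :: real
    by (intro eq_vecI) (auto simp: less_Suc_eq)
  have "(\<integral>\<^sup>+v. g v \<partial>lborel_vec (Suc n)) =
      (\<integral>\<^sup>+f. g (vec (Suc n) f) \<partial>(\<Pi>\<^sub>M i\<in>insert n {..<n}. (lborel :: real measure)))"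
    by (simp add: nn_integral_lborel_vec[OF g] lessThan_Suc)
  also have "\<dots> = (\<integral>\<^sup>+f. (\<integral>\<^sup>+t. g (vec (Suc n) (f(n := t))) \<partial>lborel) \<partial>(\<Pi>\<^sub>M i\<in>{..<n}. (lborel :: real measure)))"
    by (rule lborel_family.product_nn_integral_insert[OF _ _ gv]) auto
  also have "\<dots> = (\<integral>\<^sup>+w. (\<integral>\<^sup>+t. g (w @\<^sub>v vec 1 (\<lambda>_. t)) \<partial>lborel) \<partial>lborel_vec n)"
    by (simp only: app nn_integral_lborel_vec[OF inner])
  finally show ?thesis .
qed

lemma nn_integral_lborel_vec_0:
  assumes g: "g \<in> borel_measurable (lborel_vec 0)"
  shows "(\<integral>\<^sup>+v. g v \<partial>lborel_vec 0) = g (0\<^sub>v 0)"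
proof -
  \<comment> \<open>The product over the empty index set is a unit point mass at the function that
    is \<open>undefined\<close> everywhere, which \<open>vec 0\<close> sends to the empty
    vector.\<close>
  have "vec 0 (\<lambda>k. undefined) = (vNil :: real vec)" by (intro eq_vecI) auto
  then show ?thesis
    by (simp add: nn_integral_lborel_vec[OF g] lborel_family.nn_integral_empty)
qed

section \<open>Gaussian integrals\<close>

text \<open>Here a is an inverse variance: the integrand is a multiple of the normal density with
  mean -s and deviation 1 / sqrt a, whose mass is 1.\<close>

lemma nn_integral_gaussian_line:
  assumes a: "a > 0"
  shows "(\<integral>\<^sup>+t. ennreal (exp (- (a * (t + s)\<^sup>2) / 2)) \<partial>lborel) = ennreal (sqrt (2 * pi / a))"
proof -
  define \<sigma> where "\<sigma> = 1 / sqrt a"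
  have \<sigma>: "\<sigma> > 0" "\<sigma>\<^sup>2 = 1 / a" using a by (auto simp: \<sigma>_def power_divide)
  have "(\<integral>\<^sup>+t. ennreal (normal_density (- s) \<sigma> t) \<partial>lborel) = 1"
    using prob_space.emeasure_space_1[OF prob_space_normal_density[OF \<sigma>(1), of "- s"]]
    by (simp add: emeasure_density)
  moreover have "exp (- (a * (t + s)\<^sup>2) / 2) = sqrt (2 * pi / a) * normal_density (- s) \<sigma> t" for t
    using a by (simp add: normal_density_def \<sigma>(2) mult.commute)
  ultimately show ?thesis
    using a by (simp add: ennreal_mult' nn_integral_cmult)
qed

text \<open>The Schur complement of the last diagonal entry: the form that remains once the last
  coordinate is eliminated by completing the square.\<close>

definition schur_last :: "nat \<Rightarrow> real mat \<Rightarrow> real mat" where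
  "schur_last n P = mat n n (\<lambda>(i, j). P $$ (i, j) - P $$ (i, n) * P $$ (n, j) / P $$ (n, n))"

lemma schur_last_carrier: "schur_last n P \<in> carrier_mat n n"
  by (simp add: schur_last_def)

text \<open>Block elimination with the last diagonal entry as pivot: P = U L, where U is block upper
  triangular with the Schur complement and the pivot on its diagonal, and L is block lower
  triangular with unit diagonal.\<close>

lemma det_schur_last:
  assumes P: "P \<in> carrier_mat (Suc n) (Suc n)" and a: "P $$ (n, n) \<noteq> 0"
  shows "det P = P $$ (n, n) * det (schur_last n P)"
proof -
  let ?a = "P $$ (n, n)" and ?S = "schur_last n P"
  let ?B = "mat n 1 (\<lambda>(i, j). P $$ (i, n))" and ?C = "mat 1 n (\<lambda>(i, j). P $$ (n, j) / ?a)"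
  let ?A = "mat 1 1 (\<lambda>_. ?a)"
  let ?U = "four_block_mat ?S ?B (0\<^sub>m 1 n) ?A" and ?L = "four_block_mat (1\<^sub>m n) (0\<^sub>m n 1) ?C (1\<^sub>m 1)"
  note S = schur_last_carrier[of n P]
  have "?U * ?L = four_block_mat (?S * 1\<^sub>m n + ?B * ?C) (?S * 0\<^sub>m n 1 + ?B * 1\<^sub>m 1)
      (0\<^sub>m 1 n * 1\<^sub>m n + ?A * ?C) (0\<^sub>m 1 n * 0\<^sub>m n 1 + ?A * 1\<^sub>m 1)"
    by (rule mult_four_block_mat) (use S in auto)
  also have "\<dots> = four_block_mat (?S + ?B * ?C) ?B (?A * ?C) ?A"
  proof -
    have "0\<^sub>m 1 n + ?A * ?C = ?A * ?C"
      by (intro left_add_zero_mat mult_carrier_mat[of _ 1 1]) auto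
    with S show ?thesis by simp
  qed
  also have "\<dots> = P"
  proof (rule eq_matI)
    fix i j assume "i < dim_row P" "j < dim_col P"
    then have ij: "i < Suc n" "j < Suc n" using P by auto
    have BC: "(?B * ?C) $$ (i, j) = P $$ (i, n) * P $$ (n, j) / ?a" if "i < n" "j < n"
      using that by (simp add: scalar_prod_def)
    have AC: "(?A * ?C) $$ (0, j) = P $$ (n, j)" if "j < n"
      using that a by (simp add: scalar_prod_def)
    show "four_block_mat (?S + ?B * ?C) ?B (?A * ?C) ?A $$ (i, j) = P $$ (i, j)"
    proof (cases "i < n"; cases "j < n")
      assume "i < n" "j < n"
      then show ?thesis using BC by (simp add: schur_last_def)
    next
      assume "\<not> i < n" "j < n"
      then show ?thesis using AC ij by (simp add: schur_last_def less_Suc_eq)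
    next
      assume "i < n" "\<not> j < n"
      then show ?thesis using ij by (simp add: schur_last_def less_Suc_eq)
    next
      assume "\<not> i < n" "\<not> j < n"
      then show ?thesis using ij by (simp add: schur_last_def less_Suc_eq)
    qed
  qed (use P in \<open>auto simp: schur_last_def\<close>)
  finally have "det P = det ?U * det ?L"
    using S by (metis (no_types, lifting) det_mult four_block_carrier_mat mat_carrier one_carrier_mat)
  also have "det ?U = det ?S * det ?A"
    by (rule det_four_block_mat_lower_left_zero) (use S in auto)
  also have "det ?A = ?a" by (subst det_single) auto
  also have "det ?L = det (1\<^sub>m n :: real mat) * det (1\<^sub>m 1 :: real mat)"
    by (rule det_four_block_mat_upper_right_zero) auto
  finally show ?thesis by simp
qed

text \<open>The first form contains no division, so it can be used to show that the pivot is
  positive. The second completes the square in the last coordinate t, which leaves the Schur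
  complement.\<close>

lemma quadratic_form_append:
  assumes P: "P \<in> carrier_mat (Suc n) (Suc n)" "transpose_mat P = P" and w: "w \<in> carrier_vec n"
  defines "\<beta> \<equiv> \<Sum>i<n. P $$ (i, n) * w $ i"
  shows "(w @\<^sub>v vec 1 (\<lambda>_. t)) \<bullet> (P *\<^sub>v (w @\<^sub>v vec 1 (\<lambda>_. t))) =
      (\<Sum>i<n. \<Sum>j<n. P $$ (i, j) * (w $ i * w $ j)) + 2 * t * \<beta> + P $$ (n, n) * t\<^sup>2"
    and "P $$ (n, n) \<noteq> 0 \<Longrightarrow> (w @\<^sub>v vec 1 (\<lambda>_. t)) \<bullet> (P *\<^sub>v (w @\<^sub>v vec 1 (\<lambda>_. t))) =
      P $$ (n, n) * (t + \<beta> / P $$ (n, n))\<^sup>2 + w \<bullet> (schur_last n P *\<^sub>v w)"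
proof -
  define v where "v = w @\<^sub>v vec 1 (\<lambda>_. t)"
  let ?v = "w @\<^sub>v vec 1 (\<lambda>_. t)" and ?a = "P $$ (n, n)"
  let ?Q = "\<Sum>i<n. \<Sum>j<n. P $$ (i, j) * (w $ i * w $ j)"
  have sym: "P $$ (n, j) = P $$ (j, n)" if "j < n" for j
    using P that by (metis carrier_matD(1,2) index_transpose_mat(1) less_Suc_eq)
  have v: "v \<in> carrier_vec (Suc n)" using w unfolding v_def by (intro carrier_vecI) simp
  have vi: "v $ i = w $ i" if "i < n" for i using w that by (simp add: v_def)
  have vn: "v $ n = t" using w by (simp add: v_def)
  have "v \<bullet> (P *\<^sub>v v) = ?Q + (\<Sum>i<n. P $$ (i, n) * (w $ i * t)) +
      ((\<Sum>j<n. P $$ (n, j) * (t * w $ j)) + ?a * (t * t))"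
    by (simp add: quadratic_form_sum[OF P(1) v] vi vn sum.distrib)
  also have "(\<Sum>i<n. P $$ (i, n) * (w $ i * t)) = t * \<beta>"
    unfolding \<beta>_def sum_distrib_left by (intro sum.cong) auto
  also have "(\<Sum>j<n. P $$ (n, j) * (t * w $ j)) = t * \<beta>"
    unfolding \<beta>_def sum_distrib_left by (intro sum.cong) (auto simp: sym)
  finally show 1: "?v \<bullet> (P *\<^sub>v ?v) = ?Q + 2 * t * \<beta> + ?a * t\<^sup>2"
    by (simp add: power2_eq_square v_def)
  assume a: "?a \<noteq> 0"
  have "w \<bullet> (schur_last n P *\<^sub>v w) = (\<Sum>i<n. \<Sum>j<n. schur_last n P $$ (i, j) * (w $ i * w $ j))"
    by (rule quadratic_form_sum[OF schur_last_carrier w])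
  also have "\<dots> = (\<Sum>i<n. \<Sum>j<n. P $$ (i, j) * (w $ i * w $ j) -
      (P $$ (i, n) * w $ i) * (P $$ (j, n) * w $ j) / ?a)"
    by (intro sum.cong refl) (simp add: schur_last_def sym algebra_simps)
  also have "\<dots> = ?Q - \<beta> * \<beta> / ?a"
    unfolding \<beta>_def sum_product by (simp add: sum_subtractf flip: sum_divide_distrib)
  moreover have "?a * (t + \<beta> / ?a)\<^sup>2 = ?a * t\<^sup>2 + 2 * t * \<beta> + \<beta> * \<beta> / ?a"
    using a by (simp add: power2_eq_square field_simps)
  ultimately show "?v \<bullet> (P *\<^sub>v ?v) = ?a * (t + \<beta> / ?a)\<^sup>2 + w \<bullet> (schur_last n P *\<^sub>v w)"
    unfolding 1 by simp
qed

text \<open>Both follow by testing P on suitable vectors: the last unit vector gives the pivot, and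
  w extended by the t at which the completed square vanishes gives the Schur complement.\<close>

lemma
  assumes P: "pos_def_mat (Suc n) P"
  shows pos_def_mat_last_diag: "P $$ (n, n) > 0"
    and pos_def_mat_schur_last: "pos_def_mat n (schur_last n P)"
proof -
  note Pc = pos_def_mat_carrier[OF P] and Ps = pos_def_mat_sym[OF P]
  have pos: "(w @\<^sub>v vec 1 (\<lambda>_. t)) \<bullet> (P *\<^sub>v (w @\<^sub>v vec 1 (\<lambda>_. t))) > 0"
    if w: "w \<in> carrier_vec n" and nz: "w \<noteq> 0\<^sub>v n \<or> t \<noteq> 0" for w t
  proof -
    have "w @\<^sub>v vec 1 (\<lambda>_. t) \<noteq> 0\<^sub>v (Suc n)"
    proof
      assume eq: "w @\<^sub>v vec 1 (\<lambda>_. t) = 0\<^sub>v (Suc n)"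
      have "t = 0" using arg_cong[OF eq, of "\<lambda>v. v $ n"] w by simp
      moreover have "w = 0\<^sub>v n"
      proof (rule eq_vecI)
        fix i assume "i < dim_vec (0\<^sub>v n)"
        then show "w $ i = 0\<^sub>v n $ i" using arg_cong[OF eq, of "\<lambda>v. v $ i"] w by simp
      qed (use w in simp)
      ultimately show False using nz by simp
    qed
    moreover have "w @\<^sub>v vec 1 (\<lambda>_. t) \<in> carrier_vec (Suc n)"
      using w by (intro carrier_vecI) simp
    ultimately show ?thesis using P by (simp add: pos_def_mat_def)
  qed
  show a: "P $$ (n, n) > 0"
    using pos[of "0\<^sub>v n" 1] quadratic_form_append(1)[OF Pc Ps, of "0\<^sub>v n" 1] by simp
  have "w \<bullet> (schur_last n P *\<^sub>v w) > 0" if "w \<in> carrier_vec n" "w \<noteq> 0\<^sub>v n" for w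
    using pos[of w "- (\<Sum>i<n. P $$ (i, n) * w $ i) / P $$ (n, n)"] that a
    unfolding quadratic_form_append(2)[OF Pc Ps that(1) less_imp_neq[OF a, symmetric]] by simp
  moreover have "transpose_mat (schur_last n P) = schur_last n P"
  proof (rule eq_matI)
    fix i j assume "i < dim_row (schur_last n P)" "j < dim_col (schur_last n P)"
    then have ij: "i < n" "j < n" by (auto simp: schur_last_def)
    have sym: "P $$ (k, l) = P $$ (l, k)" if "k < Suc n" "l < Suc n" for k l
      using Pc Ps that by (metis carrier_matD(1,2) index_transpose_mat(1))
    show "transpose_mat (schur_last n P) $$ (i, j) = schur_last n P $$ (i, j)"
      using ij sym[of i j] sym[of i n] sym[of n j] by (simp add: schur_last_def)
  qed (auto simp: schur_last_def)
  ultimately show "pos_def_mat n (schur_last n P)"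
    by (simp add: pos_def_mat_def schur_last_carrier)
qed

lemma borel_measurable_exp_quadratic_form:
  assumes "P \<in> carrier_mat n n"
  shows "(\<lambda>v. ennreal (exp (- (v \<bullet> (P *\<^sub>v v)) / 2))) \<in> borel_measurable (lborel_vec n)"
proof -
  have [measurable]: "(\<lambda>v. v \<bullet> (P *\<^sub>v v)) \<in> borel_measurable (lborel_vec n)"
    using assms by (intro measurable_quadratic_form) auto
  show ?thesis by measurable
qed

text \<open>Integrating out the last coordinate contributes sqrt (2 pi / a) and leaves the form of
  the Schur complement, while det P is a times the determinant of that complement; so both sides
  obey the same recursion. Positivity of the determinant comes from it as well.\<close>

lemma gaussian_integral_and_det_pos:
  assumes "pos_def_mat n P"
  shows "det P > 0 \<and>
    (\<integral>\<^sup>+v. ennreal (exp (- (v \<bullet> (P *\<^sub>v v)) / 2)) \<partial>lborel_vec n) = ennreal (sqrt ((2 * pi) ^ n / det P))"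
  using assms
proof (induction n arbitrary: P)
  case 0
  have "P \<in> carrier_mat 0 0" using 0 by (rule pos_def_mat_carrier)
  then have "det P = 1" "P = 1\<^sub>m 0" by (auto intro!: eq_matI)
  then show ?case
    using borel_measurable_exp_quadratic_form[of P 0]
    by (subst nn_integral_lborel_vec_0) (auto simp: scalar_prod_def)
next
  case (Suc n)
  note Pc = pos_def_mat_carrier[OF Suc.prems] and Ps = pos_def_mat_sym[OF Suc.prems]
  let ?S = "schur_last n P"
  define a where "a = P $$ (n, n)"
  have a: "a > 0" unfolding a_def by (rule pos_def_mat_last_diag[OF Suc.prems])
  \<comment> \<open>The square in t is centred at - s w. The centre depends on w, but the integral
    over t does not.\<close>
  define s where "s w = (\<Sum>i<n. P $$ (i, n) * w $ i) / a" for w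
  have S: "det ?S > 0"
    "(\<integral>\<^sup>+v. ennreal (exp (- (v \<bullet> (?S *\<^sub>v v)) / 2)) \<partial>lborel_vec n) = ennreal (sqrt ((2 * pi) ^ n / det ?S))"
    using Suc.IH[OF pos_def_mat_schur_last[OF Suc.prems]] by auto
  have det: "det P = a * det ?S"
    unfolding a_def by (rule det_schur_last[OF Pc]) (use a in \<open>simp add: a_def\<close>)
  have "(\<integral>\<^sup>+v. ennreal (exp (- (v \<bullet> (P *\<^sub>v v)) / 2)) \<partial>lborel_vec (Suc n)) =
      (\<integral>\<^sup>+w. \<integral>\<^sup>+t. ennreal (exp (- ((w @\<^sub>v vec 1 (\<lambda>_. t)) \<bullet> (P *\<^sub>v (w @\<^sub>v vec 1 (\<lambda>_. t)))) / 2))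
        \<partial>lborel \<partial>lborel_vec n)"
    by (rule nn_integral_lborel_vec_Suc[OF borel_measurable_exp_quadratic_form[OF Pc]])
  also have "\<dots> = (\<integral>\<^sup>+w. ennreal (sqrt (2 * pi / a)) * ennreal (exp (- (w \<bullet> (?S *\<^sub>v w)) / 2)) \<partial>lborel_vec n)"
  proof (intro nn_integral_cong)
    fix w :: "real vec" assume "w \<in> space (lborel_vec n)"
    then have w: "w \<in> carrier_vec n" by (simp add: space_lborel_vec)
    have "(\<integral>\<^sup>+t. ennreal (exp (- ((w @\<^sub>v vec 1 (\<lambda>_. t)) \<bullet> (P *\<^sub>v (w @\<^sub>v vec 1 (\<lambda>_. t)))) / 2)) \<partial>lborel) =
        (\<integral>\<^sup>+t. ennreal (exp (- (w \<bullet> (?S *\<^sub>v w)) / 2)) * ennreal (exp (- (a * (t + s w)\<^sup>2) / 2)) \<partial>lborel)"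
    proof (intro nn_integral_cong)
      fix t :: real
      have "(w @\<^sub>v vec 1 (\<lambda>_. t)) \<bullet> (P *\<^sub>v (w @\<^sub>v vec 1 (\<lambda>_. t))) = a * (t + s w)\<^sup>2 + w \<bullet> (?S *\<^sub>v w)"
        using quadratic_form_append(2)[OF Pc Ps w] a by (simp add: a_def s_def)
      then show "ennreal (exp (- ((w @\<^sub>v vec 1 (\<lambda>_. t)) \<bullet> (P *\<^sub>v (w @\<^sub>v vec 1 (\<lambda>_. t)))) / 2)) =
          ennreal (exp (- (w \<bullet> (?S *\<^sub>v w)) / 2)) * ennreal (exp (- (a * (t + s w)\<^sup>2) / 2))"
        by (simp add: ennreal_mult'[symmetric] exp_add[symmetric] add_divide_distrib)
    qed
    also have "\<dots> = ennreal (exp (- (w \<bullet> (?S *\<^sub>v w)) / 2)) * ennreal (sqrt (2 * pi / a))"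
      by (subst nn_integral_cmult) (use nn_integral_gaussian_line[OF a] in auto)
    finally show "(\<integral>\<^sup>+t. ennreal (exp (- ((w @\<^sub>v vec 1 (\<lambda>_. t)) \<bullet> (P *\<^sub>v (w @\<^sub>v vec 1 (\<lambda>_. t)))) / 2)) \<partial>lborel) =
        ennreal (sqrt (2 * pi / a)) * ennreal (exp (- (w \<bullet> (?S *\<^sub>v w)) / 2))"
      by (simp add: mult.commute)
  qed
  also have "\<dots> = ennreal (sqrt (2 * pi / a)) * ennreal (sqrt ((2 * pi) ^ n / det ?S))"
    by (subst nn_integral_cmult) (use borel_measurable_exp_quadratic_form[OF schur_last_carrier] S(2) in auto)
  also have "\<dots> = ennreal (sqrt ((2 * pi) ^ Suc n / det P))"
    using a S(1) by (simp add: det ennreal_mult'[symmetric] real_sqrt_mult[symmetric])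
  finally show ?case using a S(1) det by simp
qed

lemmas pos_def_mat_det_pos = gaussian_integral_and_det_pos[THEN conjunct1]
  and nn_integral_gaussian = gaussian_integral_and_det_pos[THEN conjunct2]

text \<open>The Gaussian integral is antitone in its quadratic form, and it determines the determinant.\<close>

lemma det_mono_loewner:
  assumes P: "pos_def_mat n P" and T: "pos_def_mat n T"
    and le: "\<And>v. v \<in> carrier_vec n \<Longrightarrow> v \<bullet> (P *\<^sub>v v) \<le> v \<bullet> (T *\<^sub>v v)"
  shows "det P \<le> det T"
proof -
  have "(\<integral>\<^sup>+v. ennreal (exp (- (v \<bullet> (T *\<^sub>v v)) / 2)) \<partial>lborel_vec n) \<le>
      (\<integral>\<^sup>+v. ennreal (exp (- (v \<bullet> (P *\<^sub>v v)) / 2)) \<partial>lborel_vec n)"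
    using le by (intro nn_integral_mono ennreal_leI) (simp add: space_lborel_vec)
  then have "(2 * pi) ^ n / det T \<le> (2 * pi) ^ n / det P"
    unfolding nn_integral_gaussian[OF P] nn_integral_gaussian[OF T]
    using pos_def_mat_det_pos[OF P] by (simp add: ennreal_le_iff)
  then show ?thesis
    using pos_def_mat_det_pos[OF P] pos_def_mat_det_pos[OF T] by (simp add: field_simps)
qed

lemma det_inv_mat:
  assumes "pos_def_mat n S"
  shows "det (inv_mat S) = 1 / det S"
  using pos_def_mat_inv_right[OF assms] det_mult[OF pos_def_mat_carrier[OF assms]
      pos_def_mat_carrier[OF pos_def_mat_inv[OF assms]]] pos_def_mat_det_pos[OF assms]
  by (simp add: field_simps)

section \<open>Gaussian densities and their normalization\<close>

lemma measurable_gaussian_density: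
  assumes S: "pos_def_mat n S"
    and f: "f \<in> measurable M (lborel_vec n)" and g: "g \<in> measurable M (lborel_vec n)"
  shows "(\<lambda>x. gaussian_density (f x) S (g x)) \<in> borel_measurable M"
proof -
  have [measurable]: "(\<lambda>x. (g x - f x) \<bullet> (inv_mat S *\<^sub>v (g x - f x))) \<in> borel_measurable M"
    by (intro measurable_quadratic_form[of _ n] measurable_vec_minus f g
        pos_def_mat_carrier[OF pos_def_mat_inv[OF S]])
  have "(\<lambda>x. exp (- ((g x - f x) \<bullet> (inv_mat S *\<^sub>v (g x - f x))) / 2) / sqrt ((2 * pi) ^ n * det S))
      \<in> borel_measurable M"
    by measurable
  also have "?this \<longleftrightarrow> ?thesis"
    unfolding gaussian_density_def
    by (intro measurable_cong) (simp add: carrier_vecD[OF lborel_vec_carrier[OF f]])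
  finally show ?thesis .
qed

lemma gaussian_density_pos:
  assumes "pos_def_mat n S"
  shows "gaussian_density m S x > 0"
  using pos_def_mat_det_pos[OF assms] by (simp add: gaussian_density_def)

lemma nn_integral_gaussian_density:
  assumes S: "pos_def_mat n S" and m: "m \<in> carrier_vec n"
  shows "(\<integral>\<^sup>+x. ennreal (gaussian_density m S x) \<partial>lborel_vec n) = 1"
proof -
  let ?c = "1 / sqrt ((2 * pi) ^ n * det S)"
  note I = pos_def_mat_inv[OF S]
  have "(\<lambda>x. ennreal ?c * ennreal (exp (- (x \<bullet> (inv_mat S *\<^sub>v x)) / 2))) \<in> borel_measurable (lborel_vec n)"
    using borel_measurable_exp_quadratic_form[OF pos_def_mat_carrier[OF I]] by measurable
  note tr = nn_integral_lborel_vec_translate_minus[OF this m]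
  have "(\<integral>\<^sup>+x. ennreal (gaussian_density m S x) \<partial>lborel_vec n) =
      (\<integral>\<^sup>+x. ennreal ?c * ennreal (exp (- ((x - m) \<bullet> (inv_mat S *\<^sub>v (x - m))) / 2)) \<partial>lborel_vec n)"
    using m pos_def_mat_det_pos[OF S]
    by (intro nn_integral_cong) (simp add: gaussian_density_def flip: ennreal_mult')
  also have "\<dots> = (\<integral>\<^sup>+x. ennreal ?c * ennreal (exp (- (x \<bullet> (inv_mat S *\<^sub>v x)) / 2)) \<partial>lborel_vec n)"
    by (rule tr)
  also have "\<dots> = ennreal ?c * (\<integral>\<^sup>+x. ennreal (exp (- (x \<bullet> (inv_mat S *\<^sub>v x)) / 2)) \<partial>lborel_vec n)"
    by (rule nn_integral_cmult[OF borel_measurable_exp_quadratic_form[OF pos_def_mat_carrier[OF I]]])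
  also have "\<dots> = ennreal ?c * ennreal (sqrt ((2 * pi) ^ n / det (inv_mat S)))"
    by (simp only: nn_integral_gaussian[OF I])
  also have "\<dots> = 1"
    using pos_def_mat_det_pos[OF S] by (simp add: det_inv_mat[OF S] flip: ennreal_mult')
  finally show ?thesis .
qed

section \<open>The linear Gaussian model\<close>

lemma quadratic_form_uminus:
  fixes P :: "real mat"
  assumes P: "P \<in> carrier_mat n n" and v: "v \<in> carrier_vec n"
  shows "(- v) \<bullet> (P *\<^sub>v (- v)) = v \<bullet> (P *\<^sub>v v)"
proof -
  have "- v = (- 1) \<cdot>\<^sub>v v" by (intro eq_vecI) auto
  then show ?thesis using quadratic_form_smult[OF P v, of "- 1"] by simp
qed

text \<open>Bookkeeping for the residual y - A x at x = \<mu> + u + h, with a = A \<mu>, b = A u and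
  r = R w; the variable h here stands for A h.\<close>

lemma minus_vec_shift:
  fixes a b h r y :: "real vec"
  assumes "a \<in> carrier_vec m" "b \<in> carrier_vec m" "h \<in> carrier_vec m" "r \<in> carrier_vec m" "y \<in> carrier_vec m"
    and eq: "b + r = y - a"
  shows "y - (a + (b + h)) = r + - h"
proof (intro eq_vecI)
  fix i assume "i < dim_vec (r + - h)"
  then have i: "i < m" using assms by simp
  then show "(y - (a + (b + h))) $ i = (r + - h) $ i"
    using arg_cong[OF eq, of "\<lambda>v. v $ i"] assms(1-5) by simp
qed (use assms in simp)

lemma mult_mat_inv_vec:
  assumes S: "pos_def_mat n S" and v: "v \<in> carrier_vec n"
  shows "S *\<^sub>v (inv_mat S *\<^sub>v v) = v" "inv_mat S *\<^sub>v (S *\<^sub>v v) = v"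
proof -
  note c = pos_def_mat_carrier[OF S] pos_def_mat_carrier[OF pos_def_mat_inv[OF S]]
  show "S *\<^sub>v (inv_mat S *\<^sub>v v) = v" "inv_mat S *\<^sub>v (S *\<^sub>v v) = v"
    using assoc_mult_mat_vec[OF c v] assoc_mult_mat_vec[OF c(2,1) v] v
    by (simp_all add: pos_def_mat_inv_left[OF S] pos_def_mat_inv_right[OF S])
qed

text \<open>Parametrising the argument as S w + g makes the inverse cancel in every term that
  involves S w, so it survives only in the term quadratic in g. Applied to R, \<Sigma> and
  T.\<close>

lemma quadratic_form_inv_shift:
  assumes S: "pos_def_mat n S" and w: "w \<in> carrier_vec n" and g: "g \<in> carrier_vec n"
  shows "(S *\<^sub>v w + g) \<bullet> (inv_mat S *\<^sub>v (S *\<^sub>v w + g)) =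
    w \<bullet> (S *\<^sub>v w) + 2 * (w \<bullet> g) + g \<bullet> (inv_mat S *\<^sub>v g)"
proof -
  note I = pos_def_mat_inv[OF S]
  note Ic = pos_def_mat_carrier[OF I] and Is = pos_def_mat_sym[OF I]
  have Sw: "S *\<^sub>v w \<in> carrier_vec n" using pos_def_mat_carrier[OF S] w by auto
  have "(S *\<^sub>v w) \<bullet> (inv_mat S *\<^sub>v g) = g \<bullet> w"
    using symmetric_bilinear_commute[OF Ic Is Sw g] by (simp add: mult_mat_inv_vec[OF S w])
  moreover have "(S *\<^sub>v w) \<bullet> w = w \<bullet> (S *\<^sub>v w)" "g \<bullet> w = w \<bullet> g"
    using comm_scalar_prod[OF Sw w] comm_scalar_prod[OF g w] by auto
  ultimately show ?thesis
    unfolding quadratic_form_add[OF Ic Is Sw g] by (simp add: mult_mat_inv_vec[OF S w])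
qed

lemma inv_mat_smult:
  assumes S: "pos_def_mat n S" and a: "a > 0"
  shows "inv_mat (a \<cdot>\<^sub>m S) = (1 / a) \<cdot>\<^sub>m inv_mat S"
proof -
  note aS = pos_def_mat_smult[OF S a]
  note c = pos_def_mat_carrier[OF S] pos_def_mat_carrier[OF pos_def_mat_inv[OF S]]
  have "(1 / a) \<cdot>\<^sub>m (a \<cdot>\<^sub>m 1\<^sub>m n) = (1\<^sub>m n :: real mat)"
    using a by (intro eq_matI) auto
  then have "(a \<cdot>\<^sub>m S) * ((1 / a) \<cdot>\<^sub>m inv_mat S) = 1\<^sub>m n"
    using c by (simp add: mult_smult_assoc_mat[of _ n n _ n] mult_smult_distrib[of _ n n _ n]
        pos_def_mat_inv_right[OF S])
  then show ?thesis
    using c by (intro left_inverse_unique_mat[OF pos_def_mat_carrier[OF aS]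
          pos_def_mat_carrier[OF pos_def_mat_inv[OF aS]] _ pos_def_mat_inv_left[OF aS]]) auto
qed

lemma sigma_finite_pair_lborel_vec: "pair_sigma_finite (lborel_vec n) (lborel_vec m)"
  by (intro pair_sigma_finite.intro sigma_finite_lborel_vec)

lemma sets_gaussian: "m \<in> carrier_vec n \<Longrightarrow> sets (gaussian m S) = sets (lborel_vec n)"
  by (simp add: gaussian_def)

lemma nn_integral_gaussian_measure:
  assumes S: "pos_def_mat n S" and m: "m \<in> carrier_vec n"
    and f: "f \<in> borel_measurable (lborel_vec n)"
  shows "(\<integral>\<^sup>+x. f x \<partial>gaussian m S) = (\<integral>\<^sup>+x. ennreal (gaussian_density m S x) * f x \<partial>lborel_vec n)"
proof -
  have [measurable]: "gaussian_density m S \<in> borel_measurable (lborel_vec n)"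
    using measurable_gaussian_density[OF S measurable_lborel_vec_const[OF m] measurable_ident] by simp
  have "dim_vec m = n" using m by simp
  then show ?thesis unfolding gaussian_def by (simp only:) (intro nn_integral_density; use f in measurable)
qed

text \<open>The covariance of Y. Keeping R as an argument makes S and T the same expression at R and
  R / 2, so that the results about S can be reused for T.\<close>

definition marginal_cov :: "real mat \<Rightarrow> real mat \<Rightarrow> real mat \<Rightarrow> real mat" where
  "marginal_cov A \<Sigma> R = A * \<Sigma> * transpose_mat A + R"

locale linear_gaussian_model =
  fixes m n :: nat and A \<Sigma> R :: "real mat" and \<mu> :: "real vec"
  assumes A: "A \<in> carrier_mat m n" and \<mu>: "\<mu> \<in> carrier_vec n"
    and \<Sigma>: "pos_def_mat n \<Sigma>" and R: "pos_def_mat m R"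
begin

abbreviation "S \<equiv> marginal_cov A \<Sigma> R"
abbreviation "prior \<equiv> gaussian \<mu> \<Sigma>"

lemma S_pos_def: "pos_def_mat m S"
  unfolding marginal_cov_def
  by (intro pos_def_mat_add_psd R psd_mat_congruence[OF A] pos_def_mat_imp_psd \<Sigma>)

lemma congruence_carrier: "A * \<Sigma> * transpose_mat A \<in> carrier_mat m m"
  using A pos_def_mat_carrier[OF \<Sigma>] by auto

lemma S_mult_vec:
  assumes w: "w \<in> carrier_vec m"
  shows "S *\<^sub>v w = A *\<^sub>v (\<Sigma> *\<^sub>v (transpose_mat A *\<^sub>v w)) + R *\<^sub>v w"
  using A pos_def_mat_carrier[OF \<Sigma>] pos_def_mat_carrier[OF R] w congruence_carrier
  by (simp add: marginal_cov_def add_mult_distrib_mat_vec[of _ m m]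
      assoc_mult_mat_vec[of _ m n _ m] assoc_mult_mat_vec[of _ m n _ n]
      assoc_mult_mat_vec[of _ n n _ m])

lemma S_quadratic_form:
  assumes w: "w \<in> carrier_vec m"
  shows "w \<bullet> (S *\<^sub>v w) =
    (transpose_mat A *\<^sub>v w) \<bullet> (\<Sigma> *\<^sub>v (transpose_mat A *\<^sub>v w)) + w \<bullet> (R *\<^sub>v w)"
  unfolding marginal_cov_def quadratic_form_congruence[OF A pos_def_mat_carrier[OF \<Sigma>] w, symmetric]
  using congruence_carrier pos_def_mat_carrier[OF R] w
  by (simp add: add_mult_distrib_mat_vec[of _ m m] scalar_prod_add_distrib[of _ m])

text \<open>Here h is the deviation of x from its posterior mean. The cross terms of the two
  expansions are -2 w \<bullet> A h and 2 (A^T w) \<bullet> h, which cancel, and the terms in w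
  alone add up to w \<bullet> S w.\<close>

lemma complete_square:
  assumes w: "w \<in> carrier_vec m" and h: "h \<in> carrier_vec n"
  shows "(R *\<^sub>v w + - (A *\<^sub>v h)) \<bullet> (inv_mat R *\<^sub>v (R *\<^sub>v w + - (A *\<^sub>v h))) +
      (\<Sigma> *\<^sub>v (transpose_mat A *\<^sub>v w) + h) \<bullet> (inv_mat \<Sigma> *\<^sub>v (\<Sigma> *\<^sub>v (transpose_mat A *\<^sub>v w) + h)) =
    w \<bullet> (S *\<^sub>v w) + ((A *\<^sub>v h) \<bullet> (inv_mat R *\<^sub>v (A *\<^sub>v h)) + h \<bullet> (inv_mat \<Sigma> *\<^sub>v h))"
proof -
  have Ah: "A *\<^sub>v h \<in> carrier_vec m" and Aw: "transpose_mat A *\<^sub>v w \<in> carrier_vec n"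
    using A w h by auto
  have "w \<bullet> (- (A *\<^sub>v h)) = - (w \<bullet> (A *\<^sub>v h))" using w A by simp
  moreover have "(transpose_mat A *\<^sub>v w) \<bullet> h = w \<bullet> (A *\<^sub>v h)"
    by (rule transpose_vec_mult_scalar[OF A h w])
  moreover have "- (A *\<^sub>v h) \<in> carrier_vec m" using Ah by simp
  ultimately show ?thesis
    using quadratic_form_inv_shift[OF R w, of "- (A *\<^sub>v h)"] quadratic_form_inv_shift[OF \<Sigma> Aw h]
      quadratic_form_uminus[OF pos_def_mat_carrier[OF pos_def_mat_inv[OF R]] Ah] S_quadratic_form[OF w]
    by simp
qed

section \<open>The marginal density of the observation\<close>

lemma measurable_likelihood:
  "(\<lambda>p. gaussian_density (A *\<^sub>v fst p) R (snd p)) \<in> borel_measurable (lborel_vec n \<Otimes>\<^sub>M lborel_vec m)"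
  by (intro measurable_gaussian_density[OF R] measurable_mult_mat_vec[OF A] measurable_fst measurable_snd)

lemma measurable_prior_density: "gaussian_density \<mu> \<Sigma> \<in> borel_measurable (lborel_vec n)"
  using measurable_gaussian_density[OF \<Sigma> measurable_lborel_vec_const[OF \<mu>] measurable_ident] by simp

lemma measurable_marginal_density: "gaussian_density (A *\<^sub>v \<mu>) S \<in> borel_measurable (lborel_vec m)"
proof -
  have "A *\<^sub>v \<mu> \<in> carrier_vec m" using A \<mu> by auto
  then show ?thesis
    using measurable_gaussian_density[OF S_pos_def measurable_lborel_vec_const measurable_ident] by simp
qed

lemma measurable_likelihood_in_x:
  assumes y: "y \<in> carrier_vec m"
  shows "(\<lambda>x. gaussian_density (A *\<^sub>v x) R y) \<in> borel_measurable (lborel_vec n)"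
  by (intro measurable_gaussian_density[OF R] measurable_mult_mat_vec[OF A]
      measurable_ident[unfolded id_def] measurable_lborel_vec_const y)

text \<open>Completing the square shows that the marginal density is a multiple of the density of
  \<open>N(A \<mu>, S)\<close>; the factor must be 1 because both have total mass 1.\<close>

lemma nn_integral_likelihood_proportional:
  obtains c :: ennreal where "\<And>y. y \<in> carrier_vec m \<Longrightarrow>
    (\<integral>\<^sup>+x. ennreal (gaussian_density (A *\<^sub>v x) R y) \<partial>prior) = c * ennreal (gaussian_density (A *\<^sub>v \<mu>) S y)"
proof
  \<comment> \<open>\<open>F\<close>, \<open>k\<close> and \<open>q\<close> are introduced before y
    is fixed: the constant of proportionality is assembled from them alone, hence cannot depend on
    y.\<close>
  define F where "F h = ennreal (exp (- ((A *\<^sub>v h) \<bullet> (inv_mat R *\<^sub>v (A *\<^sub>v h)) + h \<bullet> (inv_mat \<Sigma> *\<^sub>v h)) / 2))" for h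
  define k where "k = 1 / (sqrt ((2 * pi) ^ n * det \<Sigma>) * sqrt ((2 * pi) ^ m * det R))"
  define q where "q = sqrt ((2 * pi) ^ m * det S)"
  have q: "q > 0" unfolding q_def using pos_def_mat_det_pos[OF S_pos_def] by simp
  have k: "k \<ge> 0" unfolding k_def using pos_def_mat_det_pos[OF R] pos_def_mat_det_pos[OF \<Sigma>] by simp
  have [measurable]: "F \<in> borel_measurable (lborel_vec n)"
  proof -
    have [measurable]: "(\<lambda>h. (A *\<^sub>v h) \<bullet> (inv_mat R *\<^sub>v (A *\<^sub>v h))) \<in> borel_measurable (lborel_vec n)"
      "(\<lambda>h. h \<bullet> (inv_mat \<Sigma> *\<^sub>v h)) \<in> borel_measurable (lborel_vec n)"
      by (intro measurable_quadratic_form[of _ m] measurable_quadratic_form[of _ n]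
          measurable_mult_mat_vec[OF A] measurable_ident[unfolded id_def]
          pos_def_mat_carrier[OF pos_def_mat_inv[OF R]] pos_def_mat_carrier[OF pos_def_mat_inv[OF \<Sigma>]])+
    show ?thesis unfolding F_def by measurable
  qed
  fix y :: "real vec" assume y: "y \<in> carrier_vec m"
  define z where "z = y - A *\<^sub>v \<mu>"
  define w where "w = inv_mat S *\<^sub>v z"
  \<comment> \<open>This is \<Sigma> A^T S^-1 (y - A \<mu>), the Kalman correction, so that \<mu> +
    u is the posterior mean of x given y.\<close>
  define u where "u = \<Sigma> *\<^sub>v (transpose_mat A *\<^sub>v w)"
  have A\<mu>: "A *\<^sub>v \<mu> \<in> carrier_vec m" using A \<mu> by auto
  have z: "z \<in> carrier_vec m" using y A\<mu> by (simp add: z_def)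
  have w: "w \<in> carrier_vec m"
    using z pos_def_mat_carrier[OF pos_def_mat_inv[OF S_pos_def]] by (simp add: w_def)
  have Aw: "transpose_mat A *\<^sub>v w \<in> carrier_vec n" using A w by auto
  have u: "u \<in> carrier_vec n" using Aw pos_def_mat_carrier[OF \<Sigma>] by (simp add: u_def)
  have Sw: "S *\<^sub>v w = z" unfolding w_def by (rule mult_mat_inv_vec(1)[OF S_pos_def z])
  have wSw: "w \<bullet> (S *\<^sub>v w) = z \<bullet> (inv_mat S *\<^sub>v z)"
    unfolding Sw using comm_scalar_prod[OF w z] by (simp add: w_def)
  have Rw: "R *\<^sub>v w \<in> carrier_vec m" and Au: "A *\<^sub>v u \<in> carrier_vec m"
    using pos_def_mat_carrier[OF R] w A u by auto
  have eq: "gaussian_density \<mu> \<Sigma> x * gaussian_density (A *\<^sub>v x) R y =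
      (k * q) * gaussian_density (A *\<^sub>v \<mu>) S y *
      exp (- ((A *\<^sub>v (x - (\<mu> + u))) \<bullet> (inv_mat R *\<^sub>v (A *\<^sub>v (x - (\<mu> + u)))) +
        (x - (\<mu> + u)) \<bullet> (inv_mat \<Sigma> *\<^sub>v (x - (\<mu> + u)))) / 2)"
    if x: "x \<in> carrier_vec n" for x
  proof -
    define h where "h = x - (\<mu> + u)"
    have h: "h \<in> carrier_vec n" using x \<mu> u by (simp add: h_def)
    have x\<mu>: "x - \<mu> = u + h" using x \<mu> u by (intro eq_vecI) (auto simp: h_def)
    have "x = \<mu> + (u + h)" using x \<mu> u by (intro eq_vecI) (auto simp: h_def)
    then have "A *\<^sub>v x = A *\<^sub>v \<mu> + (A *\<^sub>v u + A *\<^sub>v h)"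
      using A \<mu> u h by (simp add: mult_add_distrib_mat_vec[OF A])
    \<comment> \<open>The equation S w = y - A \<mu> splits the innovation into the part explained
      by x and the part left to the noise.\<close>
    moreover have "A *\<^sub>v u + R *\<^sub>v w = y - A *\<^sub>v \<mu>"
      using S_mult_vec[OF w] Sw by (simp add: u_def z_def)
    moreover have "A *\<^sub>v h \<in> carrier_vec m" using A h by auto
    ultimately have yx: "y - A *\<^sub>v x = R *\<^sub>v w + - (A *\<^sub>v h)"
      using minus_vec_shift[OF A\<mu> Au _ Rw y] by simp
    have "(y - A *\<^sub>v x) \<bullet> (inv_mat R *\<^sub>v (y - A *\<^sub>v x)) + (x - \<mu>) \<bullet> (inv_mat \<Sigma> *\<^sub>v (x - \<mu>)) =
        z \<bullet> (inv_mat S *\<^sub>v z) + ((A *\<^sub>v h) \<bullet> (inv_mat R *\<^sub>v (A *\<^sub>v h)) + h \<bullet> (inv_mat \<Sigma> *\<^sub>v h))"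
      unfolding yx x\<mu> using complete_square[OF w h] wSw by (simp add: u_def)
    then have "exp (- ((y - A *\<^sub>v x) \<bullet> (inv_mat R *\<^sub>v (y - A *\<^sub>v x))) / 2) *
        exp (- ((x - \<mu>) \<bullet> (inv_mat \<Sigma> *\<^sub>v (x - \<mu>))) / 2) =
        exp (- (z \<bullet> (inv_mat S *\<^sub>v z)) / 2) *
        exp (- ((A *\<^sub>v h) \<bullet> (inv_mat R *\<^sub>v (A *\<^sub>v h)) + h \<bullet> (inv_mat \<Sigma> *\<^sub>v h)) / 2)"
      unfolding exp_add[symmetric] by (simp add: field_simps)
    moreover have "gaussian_density (A *\<^sub>v \<mu>) S y = exp (- (z \<bullet> (inv_mat S *\<^sub>v z)) / 2) / q"
      using A by (simp add: gaussian_density_def q_def z_def)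
    moreover have "gaussian_density \<mu> \<Sigma> x * gaussian_density (A *\<^sub>v x) R y =
        k * (exp (- ((y - A *\<^sub>v x) \<bullet> (inv_mat R *\<^sub>v (y - A *\<^sub>v x))) / 2) *
        exp (- ((x - \<mu>) \<bullet> (inv_mat \<Sigma> *\<^sub>v (x - \<mu>))) / 2))"
      using A \<mu> by (simp add: gaussian_density_def k_def)
    ultimately show ?thesis
      unfolding h_def[symmetric] using q by simp
  qed
  have \<mu>u: "\<mu> + u \<in> carrier_vec n" using \<mu> u by simp
  have Fm: "(\<lambda>x. F (x - (\<mu> + u))) \<in> borel_measurable (lborel_vec n)"
    by (rule measurable_compose[OF measurable_vec_minus \<open>F \<in> _\<close>])
       (auto intro: measurable_lborel_vec_const[OF \<mu>u])
  let ?g = "gaussian_density (A *\<^sub>v \<mu>) S y"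
  have g: "?g \<ge> 0" using gaussian_density_pos[OF S_pos_def] by (simp add: less_imp_le)
  have "(\<integral>\<^sup>+x. ennreal (gaussian_density (A *\<^sub>v x) R y) \<partial>prior) =
      (\<integral>\<^sup>+x. ennreal (gaussian_density \<mu> \<Sigma> x) * ennreal (gaussian_density (A *\<^sub>v x) R y) \<partial>lborel_vec n)"
    by (rule nn_integral_gaussian_measure[OF \<Sigma> \<mu>])
       (intro measurable_compose[OF measurable_likelihood_in_x[OF y]] measurable_ennreal)
  also have "\<dots> = (\<integral>\<^sup>+x. ennreal (k * q * ?g) * F (x - (\<mu> + u)) \<partial>lborel_vec n)"
  proof (intro nn_integral_cong)
    fix x :: "real vec" assume "x \<in> space (lborel_vec n)"
    then have "x \<in> carrier_vec n" by (simp add: space_lborel_vec)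
    from eq[OF this] show "ennreal (gaussian_density \<mu> \<Sigma> x) * ennreal (gaussian_density (A *\<^sub>v x) R y) =
        ennreal (k * q * ?g) * F (x - (\<mu> + u))"
      unfolding F_def using k q g gaussian_density_pos[OF \<Sigma>, of \<mu> x]
      by (simp only: ennreal_mult'[symmetric] less_imp_le mult_nonneg_nonneg)
  qed
  also have "\<dots> = ennreal (k * q * ?g) * (\<integral>\<^sup>+x. F (x - (\<mu> + u)) \<partial>lborel_vec n)"
    by (rule nn_integral_cmult[OF Fm])
  \<comment> \<open>Translation invariance removes the posterior mean, the only trace of y left in
    this integral.\<close>
  also have "(\<integral>\<^sup>+x. F (x - (\<mu> + u)) \<partial>lborel_vec n) = (\<integral>\<^sup>+x. F x \<partial>lborel_vec n)"
    by (rule nn_integral_lborel_vec_translate_minus[OF \<open>F \<in> _\<close> \<mu>u])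
  finally show "(\<integral>\<^sup>+x. ennreal (gaussian_density (A *\<^sub>v x) R y) \<partial>prior) =
      (ennreal (k * q) * (\<integral>\<^sup>+x. F x \<partial>lborel_vec n)) * ennreal ?g"
    using k q g by (simp add: ennreal_mult mult_ac)
qed

text \<open>Integrating the proportionality over y gives c on one side. On the other, after the
  integrals are exchanged, the likelihood has mass 1 in y for every x, and the prior has mass 1.
  Since c is an \<open>ennreal\<close>, this makes sense before its finiteness is known.\<close>

lemma nn_integral_likelihood:
  assumes y: "y \<in> carrier_vec m"
  shows "(\<integral>\<^sup>+x. ennreal (gaussian_density (A *\<^sub>v x) R y) \<partial>prior) = ennreal (gaussian_density (A *\<^sub>v \<mu>) S y)"
proof -
  interpret pair_sigma_finite "lborel_vec n" "lborel_vec m" by (rule sigma_finite_pair_lborel_vec)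
  obtain c :: ennreal where c: "\<And>y. y \<in> carrier_vec m \<Longrightarrow>
      (\<integral>\<^sup>+x. ennreal (gaussian_density (A *\<^sub>v x) R y) \<partial>prior) = c * ennreal (gaussian_density (A *\<^sub>v \<mu>) S y)"
    using nn_integral_likelihood_proportional by blast
  note [measurable] = measurable_prior_density measurable_likelihood measurable_marginal_density
  have A\<mu>: "A *\<^sub>v \<mu> \<in> carrier_vec m" using A \<mu> by auto
  have "c = (\<integral>\<^sup>+y. c * ennreal (gaussian_density (A *\<^sub>v \<mu>) S y) \<partial>lborel_vec m)"
    by (simp add: nn_integral_cmult nn_integral_gaussian_density[OF S_pos_def A\<mu>])
  also have "\<dots> = (\<integral>\<^sup>+y. \<integral>\<^sup>+x. ennreal (gaussian_density (A *\<^sub>v x) R y) \<partial>prior \<partial>lborel_vec m)"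
    by (intro nn_integral_cong) (simp add: c space_lborel_vec)
  also have "\<dots> = (\<integral>\<^sup>+y. \<integral>\<^sup>+x. ennreal (gaussian_density \<mu> \<Sigma> x) * ennreal (gaussian_density (A *\<^sub>v x) R y)
      \<partial>lborel_vec n \<partial>lborel_vec m)"
    by (intro nn_integral_cong nn_integral_gaussian_measure[OF \<Sigma> \<mu>]
        measurable_compose[OF measurable_likelihood_in_x] measurable_ennreal) (simp add: space_lborel_vec)
  also have "\<dots> = (\<integral>\<^sup>+x. \<integral>\<^sup>+y. ennreal (gaussian_density \<mu> \<Sigma> x) * ennreal (gaussian_density (A *\<^sub>v x) R y)
      \<partial>lborel_vec m \<partial>lborel_vec n)"
    by (rule Fubini') (use measurable_likelihood in \<open>simp add: split_beta\<close>)
  also have "\<dots> = (\<integral>\<^sup>+x. ennreal (gaussian_density \<mu> \<Sigma> x) \<partial>lborel_vec n)"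
  proof (intro nn_integral_cong)
    fix x :: "real vec" assume "x \<in> space (lborel_vec n)"
    then have Ax: "A *\<^sub>v x \<in> carrier_vec m" using A by (auto simp: space_lborel_vec)
    have [measurable]: "gaussian_density (A *\<^sub>v x) R \<in> borel_measurable (lborel_vec m)"
      using measurable_gaussian_density[OF R measurable_lborel_vec_const[OF Ax] measurable_ident] by simp
    show "(\<integral>\<^sup>+y. ennreal (gaussian_density \<mu> \<Sigma> x) * ennreal (gaussian_density (A *\<^sub>v x) R y) \<partial>lborel_vec m) =
        ennreal (gaussian_density \<mu> \<Sigma> x)"
      by (simp add: nn_integral_cmult nn_integral_gaussian_density[OF R Ax])
  qed
  also have "\<dots> = 1" by (rule nn_integral_gaussian_density[OF \<Sigma> \<mu>])
  finally show ?thesis using c[OF y] by simp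
qed

text \<open>\<open>evidence\<close> is a Bochner integral, which would default to 0 without
  integrability. Measurability and nonnegativity turn it into \<open>enn2real\<close> of the
  nonnegative integral, whose value is finite.\<close>

lemma evidence_eq:
  assumes y: "y \<in> carrier_vec m"
  shows "evidence A R prior y = gaussian_density (A *\<^sub>v \<mu>) S y"
proof -
  have "(\<lambda>x. gaussian_density (A *\<^sub>v x) R y) \<in> borel_measurable prior"
    using measurable_likelihood_in_x[OF y] measurable_cong_sets[OF sets_gaussian[OF \<mu>] refl] by blast
  then have "evidence A R prior y = enn2real (\<integral>\<^sup>+x. ennreal (gaussian_density (A *\<^sub>v x) R y) \<partial>prior)"
    unfolding evidence_def likelihood_def
    by (intro integral_eq_nn_integral) (auto simp: gaussian_density_pos[OF R] less_imp_le)
  then show ?thesis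
    using gaussian_density_pos[OF S_pos_def] by (simp add: nn_integral_likelihood[OF y] less_imp_le)
qed

end

section \<open>The second moment of the link function\<close>

lemma vec_add_minus_cancel:
  fixes a y :: "real vec"
  shows "a \<in> carrier_vec m \<Longrightarrow> y \<in> carrier_vec m \<Longrightarrow> a + (y - a) = y"
  by (intro eq_vecI) auto

lemma vec_minus_zero:
  fixes y :: "real vec"
  shows "y \<in> carrier_vec m \<Longrightarrow> y - 0\<^sub>v m = y"
  by (intro eq_vecI) auto

text \<open>With D = (2 pi)^n det S, the normaliser of the square is D and that of the density with
  covariance S / 2 is sqrt (D / 2^n); their ratio is the prefactor 1 / sqrt (2^n D).\<close>

lemma gaussian_density_power2:
  assumes S: "pos_def_mat n S" and x: "x \<in> carrier_vec n" and m: "m \<in> carrier_vec n"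
  shows "(gaussian_density m S x)\<^sup>2 =
    1 / sqrt (2 ^ n * ((2 * pi) ^ n * det S)) * gaussian_density m ((1 / 2) \<cdot>\<^sub>m S) x"
proof -
  define q where "q = (x - m) \<bullet> (inv_mat S *\<^sub>v (x - m))"
  define D where "D = (2 * pi) ^ n * det S"
  have D: "D > 0" using pos_def_mat_det_pos[OF S] by (simp add: D_def)
  have n: "dim_vec m = n" using m by simp
  have xm: "x - m \<in> carrier_vec n" using x m by simp
  have "inv_mat ((1 / 2) \<cdot>\<^sub>m S) = 2 \<cdot>\<^sub>m inv_mat S"
    using inv_mat_smult[OF S, of "1 / 2"] by simp
  then have "(x - m) \<bullet> (inv_mat ((1 / 2) \<cdot>\<^sub>m S) *\<^sub>v (x - m)) = 2 * q"
    using quadratic_form_smult_mat[OF pos_def_mat_carrier[OF pos_def_mat_inv[OF S]] xm]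
    by (simp add: q_def)
  moreover have "det ((1 / 2) \<cdot>\<^sub>m S) = det S / 2 ^ n"
    using pos_def_mat_carrier[OF S] by (simp add: power_one_over)
  ultimately have "gaussian_density m ((1 / 2) \<cdot>\<^sub>m S) x = exp (- q) / sqrt (D / 2 ^ n)"
    by (simp add: gaussian_density_def n D_def)
  moreover have "sqrt (2 ^ n * D) * sqrt (D / 2 ^ n) = D"
    using D by (simp flip: real_sqrt_mult)
  moreover have "(gaussian_density m S x)\<^sup>2 = exp (- q) / D"
    using D by (simp add: gaussian_density_def n D_def q_def power_divide flip: exp_double)
  ultimately show ?thesis unfolding D_def[symmetric] by simp
qed

context linear_gaussian_model
begin

lemma measurable_likelihood_prior:
  assumes y: "y \<in> carrier_vec m"
  shows "(\<lambda>x. ennreal (gaussian_density (A *\<^sub>v x) R y)) \<in> borel_measurable prior"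
  using measurable_compose[OF measurable_likelihood_in_x[OF y] measurable_ennreal]
  by (simp add: measurable_cong_sets[OF sets_gaussian[OF \<mu>] refl])

abbreviation "T \<equiv> marginal_cov A \<Sigma> ((1 / 2) \<cdot>\<^sub>m R)"

lemma half: "linear_gaussian_model m n A \<Sigma> ((1 / 2) \<cdot>\<^sub>m R) \<mu>"
  using A \<mu> \<Sigma> pos_def_mat_smult[OF R] by unfold_locales auto

lemmas T_pos_def = linear_gaussian_model.S_pos_def[OF half]

lemma S_eq_T_plus:
  assumes w: "w \<in> carrier_vec m"
  shows "S *\<^sub>v w = T *\<^sub>v w + (1 / 2) \<cdot>\<^sub>v (R *\<^sub>v w)"
proof -
  have Rw: "R *\<^sub>v w \<in> carrier_vec m" using pos_def_mat_carrier[OF R] w by auto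
  have B: "A *\<^sub>v (\<Sigma> *\<^sub>v (transpose_mat A *\<^sub>v w)) \<in> carrier_vec m"
    using A pos_def_mat_carrier[OF \<Sigma>] w by auto
  show ?thesis
    unfolding S_mult_vec[OF w] linear_gaussian_model.S_mult_vec[OF half w]
      smult_mat_mult_vec[OF pos_def_mat_carrier[OF R] w]
  proof (rule eq_vecI)
    fix i assume "i < dim_vec (A *\<^sub>v (\<Sigma> *\<^sub>v (transpose_mat A *\<^sub>v w)) + (1 / 2) \<cdot>\<^sub>v (R *\<^sub>v w) + (1 / 2) \<cdot>\<^sub>v (R *\<^sub>v w))"
    then have i: "i < dim_vec (R *\<^sub>v w)" by simp
    then show "(A *\<^sub>v (\<Sigma> *\<^sub>v (transpose_mat A *\<^sub>v w)) + R *\<^sub>v w) $ i =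
        (A *\<^sub>v (\<Sigma> *\<^sub>v (transpose_mat A *\<^sub>v w)) + (1 / 2) \<cdot>\<^sub>v (R *\<^sub>v w) + (1 / 2) \<cdot>\<^sub>v (R *\<^sub>v w)) $ i"
      using carrier_vecD[OF B] carrier_vecD[OF Rw] by (simp del: index_mult_mat_vec)
  qed simp
qed

text \<open>With \<open>v = S w = T w + g\<close> and \<open>g = R w / 2\<close>, the difference of the two inverse forms at \<open>v\<close> is
  \<open>w \<bullet> g + g \<bullet> T\<^sup>-\<^sup>1 g\<close>.\<close>

lemma inv_T_minus_inv_S_pos_def: "pos_def_mat m (inv_mat T - inv_mat S)"
proof -
  note IT = pos_def_mat_inv[OF T_pos_def] and IS = pos_def_mat_inv[OF S_pos_def]
  note Tc = pos_def_mat_carrier[OF IT] and Sc = pos_def_mat_carrier[OF IS]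
  have "v \<bullet> ((inv_mat T - inv_mat S) *\<^sub>v v) > 0" if v: "v \<in> carrier_vec m" "v \<noteq> 0\<^sub>v m" for v
  proof -
    define w where "w = inv_mat S *\<^sub>v v"
    define g where "g = (1 / 2) \<cdot>\<^sub>v (R *\<^sub>v w)"
    have w: "w \<in> carrier_vec m" using Sc v by (simp add: w_def)
    have Rw: "R *\<^sub>v w \<in> carrier_vec m" using pos_def_mat_carrier[OF R] w by auto
    have g: "g \<in> carrier_vec m" using Rw by (simp add: g_def)
    have Tw: "T *\<^sub>v w \<in> carrier_vec m" using pos_def_mat_carrier[OF T_pos_def] w by auto
    have Sw: "S *\<^sub>v w = v" unfolding w_def by (rule mult_mat_inv_vec(1)[OF S_pos_def v(1)])
    then have vTg: "v = T *\<^sub>v w + g" unfolding g_def S_eq_T_plus[OF w] by simp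
    have "w \<noteq> 0\<^sub>v m"
      using Sw v(2) mult_mat_zero_vec[OF pos_def_mat_carrier[OF S_pos_def]] by auto
    then have wg: "w \<bullet> g > 0"
      using R w Rw by (simp add: g_def pos_def_mat_def)
    have gg: "g \<bullet> (inv_mat T *\<^sub>v g) \<ge> 0"
      using pos_def_mat_imp_psd[OF IT] g by (simp add: psd_mat_def)
    have "v \<bullet> (inv_mat T *\<^sub>v v) = w \<bullet> (T *\<^sub>v w) + 2 * (w \<bullet> g) + g \<bullet> (inv_mat T *\<^sub>v g)"
      unfolding vTg by (rule quadratic_form_inv_shift[OF T_pos_def w g])
    moreover have "v \<bullet> (inv_mat S *\<^sub>v v) = w \<bullet> (T *\<^sub>v w) + w \<bullet> g"
    proof -
      have "v \<bullet> (inv_mat S *\<^sub>v v) = w \<bullet> v"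
        unfolding w_def[symmetric] by (rule comm_scalar_prod[OF v(1) w])
      also have "\<dots> = w \<bullet> (T *\<^sub>v w) + w \<bullet> g"
        unfolding vTg by (rule scalar_prod_add_distrib[OF w Tw g])
      finally show ?thesis .
    qed
    moreover have "v \<bullet> ((inv_mat T - inv_mat S) *\<^sub>v v) = v \<bullet> (inv_mat T *\<^sub>v v) - v \<bullet> (inv_mat S *\<^sub>v v)"
      unfolding minus_mult_distrib_mat_vec[OF Tc Sc v(1)]
      by (rule scalar_prod_minus_distrib[OF v(1)]) (use Tc Sc v in auto)
    ultimately show ?thesis using wg gg by simp
  qed
  moreover have "transpose_mat (inv_mat T - inv_mat S) = inv_mat T - inv_mat S"
    using transpose_minus[OF Tc Sc] pos_def_mat_sym[OF IT] pos_def_mat_sym[OF IS] by simp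
  ultimately show ?thesis using Tc Sc by (simp add: pos_def_mat_def minus_carrier_mat)
qed

text \<open>Multiplying by T on the left and by S on the right clears both inverses and leaves S - T
  = R / 2; halving an m by m matrix divides its determinant by 2^m.\<close>

lemma det_inv_T_minus_inv_S: "det T * det (inv_mat T - inv_mat S) * det S = det R / 2 ^ m"
proof -
  note IT = pos_def_mat_inv[OF T_pos_def] and IS = pos_def_mat_inv[OF S_pos_def]
  note c = pos_def_mat_carrier[OF IT] pos_def_mat_carrier[OF IS]
    pos_def_mat_carrier[OF T_pos_def] pos_def_mat_carrier[OF S_pos_def] pos_def_mat_carrier[OF R]
  have "T * (inv_mat T - inv_mat S) * S = (1\<^sub>m m - T * inv_mat S) * S"
    using mult_minus_distrib_mat[OF c(3,1,2)] pos_def_mat_inv_right[OF T_pos_def] by simp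
  also have "\<dots> = 1\<^sub>m m * S - T * inv_mat S * S"
    using c by (intro minus_mult_distrib_mat[of _ m m _ _ m]) auto
  also have "T * inv_mat S * S = T * (inv_mat S * S)"
    by (rule assoc_mult_mat[OF c(3,2,4)])
  also have "\<dots> = T" using c(3) by (simp add: pos_def_mat_inv_left[OF S_pos_def])
  also have "1\<^sub>m m * S - T = (1 / 2) \<cdot>\<^sub>m R"
    using c congruence_carrier unfolding marginal_cov_def by (intro eq_matI) auto
  finally have "det (T * (inv_mat T - inv_mat S) * S) = det ((1 / 2) \<cdot>\<^sub>m R)" by simp
  moreover have "det (T * (inv_mat T - inv_mat S) * S) = det T * det (inv_mat T - inv_mat S) * det S"
    using c by (simp add: det_mult[of _ m] minus_carrier_mat del: assoc_mult_mat)
  ultimately show ?thesis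
    using c(5) by (simp add: power_one_over)
qed

text \<open>The evidence does not depend on x and leaves the integral. The squared likelihood is a
  multiple of the likelihood with noise R / 2, and the prior mean of the latter is the marginal
  density of that model, which has covariance T.\<close>

lemma L2_norm_sq_link:
  assumes y: "y \<in> carrier_vec m"
  shows "L2_norm_sq prior (link A R prior y) =
    ennreal (1 / sqrt (2 ^ m * ((2 * pi) ^ m * det R)) * gaussian_density (A *\<^sub>v \<mu>) T y /
      (gaussian_density (A *\<^sub>v \<mu>) S y)\<^sup>2)"
proof -
  let ?c = "1 / sqrt (2 ^ m * ((2 * pi) ^ m * det R)) / (gaussian_density (A *\<^sub>v \<mu>) S y)\<^sup>2"
  have c: "?c \<ge> 0" using pos_def_mat_det_pos[OF R] by simp
  have "L2_norm_sq prior (link A R prior y) =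
      (\<integral>\<^sup>+x. ennreal ?c * ennreal (gaussian_density (A *\<^sub>v x) ((1 / 2) \<cdot>\<^sub>m R) y) \<partial>prior)"
    unfolding L2_norm_sq_def link_def likelihood_def evidence_eq[OF y]
  proof (intro nn_integral_cong)
    fix x assume "x \<in> space prior"
    then have "x \<in> carrier_vec n"
      using sets_eq_imp_space_eq[OF sets_gaussian[OF \<mu>]] by (auto simp: space_lborel_vec)
    then have Ax: "A *\<^sub>v x \<in> carrier_vec m" using A by auto
    show "ennreal ((gaussian_density (A *\<^sub>v x) R y / gaussian_density (A *\<^sub>v \<mu>) S y)\<^sup>2) =
        ennreal ?c * ennreal (gaussian_density (A *\<^sub>v x) ((1 / 2) \<cdot>\<^sub>m R) y)"
      using c by (simp add: power_divide gaussian_density_power2[OF R y Ax] flip: ennreal_mult')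
  qed
  also have "\<dots> = ennreal ?c * ennreal (gaussian_density (A *\<^sub>v \<mu>) T y)"
  proof -
    have "(\<lambda>x. ennreal (gaussian_density (A *\<^sub>v x) ((1 / 2) \<cdot>\<^sub>m R) y)) \<in> borel_measurable prior"
      by (rule linear_gaussian_model.measurable_likelihood_prior[OF half y])
    then show ?thesis
      by (simp only: nn_integral_cmult linear_gaussian_model.nn_integral_likelihood[OF half y])
  qed
  finally show ?thesis using c by (simp flip: ennreal_mult')
qed

lemma measurable_L2_norm_sq_link:
  "(\<lambda>y. L2_norm_sq prior (link A R prior y)) \<in> borel_measurable (lborel_vec m)"
proof -
  note [measurable] = measurable_marginal_density linear_gaussian_model.measurable_marginal_density[OF half]
  have "(\<lambda>y. ennreal (1 / sqrt (2 ^ m * ((2 * pi) ^ m * det R)) * gaussian_density (A *\<^sub>v \<mu>) T y /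
      (gaussian_density (A *\<^sub>v \<mu>) S y)\<^sup>2)) \<in> borel_measurable (lborel_vec m)"
    by measurable
  also have "?this \<longleftrightarrow> ?thesis"
    by (intro measurable_cong) (simp add: L2_norm_sq_link space_lborel_vec)
  finally show ?thesis .
qed

lemma nn_integral_evidence_law:
  assumes f: "f \<in> borel_measurable (lborel_vec m)"
  shows "(\<integral>\<^sup>+y. f y \<partial>evidence_law A R prior) =
    (\<integral>\<^sup>+y. ennreal (gaussian_density (A *\<^sub>v \<mu>) S y) * f y \<partial>lborel_vec m)"
proof -
  have m: "dim_row A = m" using A by simp
  have "gaussian_density (A *\<^sub>v \<mu>) S \<in> borel_measurable (lborel_vec m)"
    by (rule measurable_marginal_density)
  also have "?this \<longleftrightarrow> evidence A R prior \<in> borel_measurable (lborel_vec m)"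
    by (intro measurable_cong) (simp add: evidence_eq space_lborel_vec)
  finally have "(\<lambda>y. ennreal (evidence A R prior y)) \<in> borel_measurable (lborel_vec m)"
    by measurable
  then have "(\<integral>\<^sup>+y. f y \<partial>evidence_law A R prior) = (\<integral>\<^sup>+y. ennreal (evidence A R prior y) * f y \<partial>lborel_vec m)"
    unfolding evidence_law_def m by (rule nn_integral_density) (rule f)
  also have "\<dots> = (\<integral>\<^sup>+y. ennreal (gaussian_density (A *\<^sub>v \<mu>) S y) * f y \<partial>lborel_vec m)"
    by (intro nn_integral_cong) (simp add: evidence_eq space_lborel_vec)
  finally show ?thesis .
qed

lemma K2_eq: "K2 A R prior = ennreal (det S / det R)"
proof -
  let ?D = "inv_mat T - inv_mat S" and ?a = "A *\<^sub>v \<mu>"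
  define p where "p = (2 * pi) ^ m"
  define e where "e = (2 :: real) ^ m"
  \<comment> \<open>The first factor comes from squaring the likelihood, the other two from the
    normalisers in the quotient of the densities with covariances T and S.\<close>
  define k where "k = 1 / sqrt (e * (p * det R)) * sqrt (p * det S) / sqrt (p * det T)"
  have pos: "p > 0" "e > 0" "det S > 0" "det T > 0" "det R > 0" "det ?D > 0"
    using pos_def_mat_det_pos R S_pos_def T_pos_def inv_T_minus_inv_S_pos_def
    by (auto simp: p_def e_def)
  have k: "k \<ge> 0" using pos by (simp add: k_def)
  have a: "?a \<in> carrier_vec m" using A \<mu> by auto
  have Dc: "?D \<in> carrier_mat m m" by (rule pos_def_mat_carrier[OF inv_T_minus_inv_S_pos_def])
  note Tc = pos_def_mat_carrier[OF pos_def_mat_inv[OF T_pos_def]]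
    and Sc = pos_def_mat_carrier[OF pos_def_mat_inv[OF S_pos_def]]
  have "K2 A R prior = (\<integral>\<^sup>+y. ennreal (gaussian_density ?a S y) * L2_norm_sq prior (link A R prior y) \<partial>lborel_vec m)"
    unfolding K2_def by (rule nn_integral_evidence_law[OF measurable_L2_norm_sq_link])
  also have "\<dots> = (\<integral>\<^sup>+y. ennreal k * ennreal (exp (- ((y - ?a) \<bullet> (?D *\<^sub>v (y - ?a))) / 2)) \<partial>lborel_vec m)"
  proof (intro nn_integral_cong)
    fix y :: "real vec" assume "y \<in> space (lborel_vec m)"
    then have y: "y \<in> carrier_vec m" by (simp add: space_lborel_vec)
    define z where "z = y - ?a"
    have z: "z \<in> carrier_vec m" using y a by (simp add: z_def)
    let ?g = "gaussian_density ?a S y" and ?h = "gaussian_density ?a T y"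
    have g: "?g > 0" by (rule gaussian_density_pos[OF S_pos_def])
    have "z \<bullet> (?D *\<^sub>v z) = z \<bullet> (inv_mat T *\<^sub>v z) - z \<bullet> (inv_mat S *\<^sub>v z)"
      unfolding minus_mult_distrib_mat_vec[OF Tc Sc z]
      by (rule scalar_prod_minus_distrib[OF z]) (use Tc Sc z in auto)
    then have ex: "exp (- (z \<bullet> (inv_mat T *\<^sub>v z)) / 2) =
        exp (- (z \<bullet> (?D *\<^sub>v z)) / 2) * exp (- (z \<bullet> (inv_mat S *\<^sub>v z)) / 2)"
      unfolding exp_add[symmetric] by (simp add: field_simps)
    have "?h = exp (- (z \<bullet> (inv_mat T *\<^sub>v z)) / 2) / sqrt (p * det T)"
      "?g = exp (- (z \<bullet> (inv_mat S *\<^sub>v z)) / 2) / sqrt (p * det S)"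
      using A by (simp_all add: gaussian_density_def z_def p_def)
    then have "?h / ?g = sqrt (p * det S) / sqrt (p * det T) * exp (- (z \<bullet> (?D *\<^sub>v z)) / 2)"
      unfolding ex by simp
    \<comment> \<open>The density of \<eta> cancels one of the two evidence factors in the
      denominator of the squared link.\<close>
    moreover have "?g * (1 / sqrt (e * (p * det R)) * ?h / ?g\<^sup>2) = 1 / sqrt (e * (p * det R)) * (?h / ?g)"
      using g by (simp add: power2_eq_square)
    ultimately have "?g * (1 / sqrt (e * (p * det R)) * ?h / ?g\<^sup>2) = k * exp (- (z \<bullet> (?D *\<^sub>v z)) / 2)"
      by (simp add: k_def)
    then show "ennreal ?g * L2_norm_sq prior (link A R prior y) =
        ennreal k * ennreal (exp (- ((y - ?a) \<bullet> (?D *\<^sub>v (y - ?a))) / 2))"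
      unfolding L2_norm_sq_link[OF y] p_def[symmetric] e_def[symmetric] z_def[symmetric]
      using g k by (simp flip: ennreal_mult')
  qed
  also have "\<dots> = (\<integral>\<^sup>+y. ennreal k * ennreal (exp (- (y \<bullet> (?D *\<^sub>v y)) / 2)) \<partial>lborel_vec m)"
  proof -
    have "(\<lambda>y. ennreal k * ennreal (exp (- (y \<bullet> (?D *\<^sub>v y)) / 2))) \<in> borel_measurable (lborel_vec m)"
      using borel_measurable_exp_quadratic_form[OF Dc] by measurable
    from nn_integral_lborel_vec_translate_minus[OF this a] show ?thesis .
  qed
  also have "\<dots> = ennreal k * (\<integral>\<^sup>+y. ennreal (exp (- (y \<bullet> (?D *\<^sub>v y)) / 2)) \<partial>lborel_vec m)"
    by (rule nn_integral_cmult[OF borel_measurable_exp_quadratic_form[OF Dc]])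
  also have "\<dots> = ennreal (k * sqrt (p / det ?D))"
    unfolding nn_integral_gaussian[OF inv_T_minus_inv_S_pos_def] p_def[symmetric]
    using k by (simp flip: ennreal_mult')
  also have "k * sqrt (p / det ?D) = det S / det R"
  proof -
    have D: "det ?D = det R / (e * det T * det S)"
      using det_inv_T_minus_inv_S pos by (simp add: e_def field_simps)
    \<comment> \<open>The reciprocal of det (T^-1 - S^-1) is 2^m det T det S / det R. Under a single
      square root the powers of 2 pi and of 2 and the factor det T cancel, and a perfect square
      remains.\<close>
    have "k * sqrt (p / det ?D) = sqrt (1 / (e * (p * det R)) * (p * det S) / (p * det T) * (p / det ?D))"
      by (simp add: k_def real_sqrt_mult real_sqrt_divide)
    also have "1 / (e * (p * det R)) * (p * det S) / (p * det T) * (p / det ?D) = (det S / det R)\<^sup>2"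
      unfolding D using pos by (simp add: power2_eq_square field_simps)
    finally show ?thesis using pos by simp
  qed
  finally show ?thesis .
qed

text \<open>Says that \<eta> is the law of A X + V, which turns the integral defining
  \<open>K2\<close> into an expectation. Independence makes the joint law a product, the
  substitution y = A x + v turns the noise density into the likelihood, and integrating over x first
  produces the evidence.\<close>

lemma nn_integral_observation_law:
  assumes M: "prob_space M"
    and X: "X \<in> measurable M (lborel_vec n)" and X_law: "distr M (lborel_vec n) X = prior"
    and V: "V \<in> measurable M (lborel_vec m)" and V_law: "distr M (lborel_vec m) V = gaussian (0\<^sub>v m) R"
    and indep: "prob_space.indep_var M (lborel_vec n) X (lborel_vec m) V"
    and h: "h \<in> borel_measurable (lborel_vec m)"
  shows "(\<integral>\<^sup>+\<omega>. h (A *\<^sub>v X \<omega> + V \<omega>) \<partial>M) = (\<integral>\<^sup>+y. h y \<partial>evidence_law A R prior)"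
proof -
  interpret prob_space M by (rule M)
  interpret L: pair_sigma_finite "lborel_vec n" "lborel_vec m" by (rule sigma_finite_pair_lborel_vec)
  let ?g = "gaussian (0\<^sub>v m) R"
  have joint: "distr M (lborel_vec n \<Otimes>\<^sub>M lborel_vec m) (\<lambda>\<omega>. (X \<omega>, V \<omega>)) = prior \<Otimes>\<^sub>M ?g"
    using indep X V unfolding indep_var_distribution_eq by (simp add: X_law V_law)
  interpret G: prob_space ?g
    unfolding V_law[symmetric] by (rule prob_space_distr[OF V])
  have sum: "(\<lambda>p. A *\<^sub>v fst p + snd p) \<in> measurable (lborel_vec n \<Otimes>\<^sub>M lborel_vec m) (lborel_vec m)"
    by (intro measurable_vec_add measurable_mult_mat_vec[OF A] measurable_fst measurable_snd)
  have hs: "(\<lambda>p. h (A *\<^sub>v fst p + snd p)) \<in> borel_measurable (lborel_vec n \<Otimes>\<^sub>M lborel_vec m)"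
    by (rule measurable_compose[OF sum h])
  have sets_eq: "sets (prior \<Otimes>\<^sub>M ?g) = sets (lborel_vec n \<Otimes>\<^sub>M lborel_vec m)"
    by (intro sets_pair_measure_cong sets_gaussian[OF \<mu>] sets_gaussian) simp
  have z: "0\<^sub>v m \<in> carrier_vec m" by simp
  have "(\<integral>\<^sup>+\<omega>. h (A *\<^sub>v X \<omega> + V \<omega>) \<partial>M) =
      (\<integral>\<^sup>+p. h (A *\<^sub>v fst p + snd p) \<partial>distr M (lborel_vec n \<Otimes>\<^sub>M lborel_vec m) (\<lambda>\<omega>. (X \<omega>, V \<omega>)))"
    by (subst nn_integral_distr) (use X V hs in \<open>auto intro: measurable_Pair\<close>)
  also have "\<dots> = (\<integral>\<^sup>+x. \<integral>\<^sup>+v. h (A *\<^sub>v x + v) \<partial>?g \<partial>prior)"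
    unfolding joint using hs measurable_cong_sets[OF sets_eq refl]
    by (subst G.nn_integral_fst[symmetric]) auto
  also have "\<dots> = (\<integral>\<^sup>+x. \<integral>\<^sup>+y. h y * ennreal (gaussian_density (A *\<^sub>v x) R y) \<partial>lborel_vec m \<partial>prior)"
  proof (intro nn_integral_cong)
    fix x assume "x \<in> space prior"
    then have x: "x \<in> carrier_vec n"
      using sets_eq_imp_space_eq[OF sets_gaussian[OF \<mu>]] by (auto simp: space_lborel_vec)
    then have Ax: "A *\<^sub>v x \<in> carrier_vec m" using A by auto
    have id: "(\<lambda>v. v) \<in> measurable (lborel_vec m) (lborel_vec m)" by simp
    have hx: "(\<lambda>v. h (A *\<^sub>v x + v)) \<in> borel_measurable (lborel_vec m)"
      by (rule measurable_compose[OF measurable_vec_add[OF measurable_lborel_vec_const[OF Ax] id] h])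
    have [measurable]: "gaussian_density (0\<^sub>v m) R \<in> borel_measurable (lborel_vec m)"
      using measurable_gaussian_density[OF R measurable_lborel_vec_const[OF z] id] by simp
    have G: "(\<lambda>v. ennreal (gaussian_density (0\<^sub>v m) R v) * h (A *\<^sub>v x + v)) \<in> borel_measurable (lborel_vec m)"
      using hx by measurable
    have "(\<integral>\<^sup>+v. h (A *\<^sub>v x + v) \<partial>?g) =
        (\<integral>\<^sup>+v. ennreal (gaussian_density (0\<^sub>v m) R v) * h (A *\<^sub>v x + v) \<partial>lborel_vec m)"
      by (rule nn_integral_gaussian_measure[OF R z hx])
    also have "\<dots> = (\<integral>\<^sup>+y. ennreal (gaussian_density (0\<^sub>v m) R (y - A *\<^sub>v x)) * h (A *\<^sub>v x + (y - A *\<^sub>v x)) \<partial>lborel_vec m)"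
      by (rule nn_integral_lborel_vec_translate_minus[OF G Ax, symmetric])
    also have "\<dots> = (\<integral>\<^sup>+y. h y * ennreal (gaussian_density (A *\<^sub>v x) R y) \<partial>lborel_vec m)"
    proof (intro nn_integral_cong)
      fix y :: "real vec" assume "y \<in> space (lborel_vec m)"
      then have y: "y \<in> carrier_vec m" by (simp add: space_lborel_vec)
      have "A *\<^sub>v x + (y - A *\<^sub>v x) = y" "y - A *\<^sub>v x - 0\<^sub>v m = y - A *\<^sub>v x"
        using Ax y vec_add_minus_cancel[OF Ax y] vec_minus_zero[of "y - A *\<^sub>v x" m] by auto
      then show "ennreal (gaussian_density (0\<^sub>v m) R (y - A *\<^sub>v x)) * h (A *\<^sub>v x + (y - A *\<^sub>v x)) =
          h y * ennreal (gaussian_density (A *\<^sub>v x) R y)"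
        using A by (simp add: gaussian_density_def mult.commute)
    qed
    finally show "(\<integral>\<^sup>+v. h (A *\<^sub>v x + v) \<partial>?g) =
        (\<integral>\<^sup>+y. h y * ennreal (gaussian_density (A *\<^sub>v x) R y) \<partial>lborel_vec m)" .
  qed
  also have "\<dots> = (\<integral>\<^sup>+y. \<integral>\<^sup>+x. h y * ennreal (gaussian_density (A *\<^sub>v x) R y) \<partial>prior \<partial>lborel_vec m)"
  proof -
    \<comment> \<open>As the law of X the prior has mass 1, hence is sigma-finite, as the exchange
      of integrals requires.\<close>
    interpret P: prob_space prior
      unfolding X_law[symmetric] by (rule prob_space_distr[OF X])
    interpret sigma_finite_measure "lborel_vec m" by (rule sigma_finite_lborel_vec)
    interpret PL: pair_sigma_finite prior "lborel_vec m" by unfold_locales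
    have s: "sets (prior \<Otimes>\<^sub>M lborel_vec m) = sets (lborel_vec n \<Otimes>\<^sub>M lborel_vec m)"
      by (intro sets_pair_measure_cong sets_gaussian[OF \<mu>]) simp
    have "(\<lambda>p. h (snd p) * ennreal (gaussian_density (A *\<^sub>v fst p) R (snd p)))
        \<in> borel_measurable (lborel_vec n \<Otimes>\<^sub>M lborel_vec m)"
      using measurable_compose[OF measurable_snd h] measurable_likelihood by measurable
    then show ?thesis
      by (intro PL.Fubini'[symmetric]) (simp add: split_beta measurable_cong_sets[OF s refl])
  qed
  also have "\<dots> = (\<integral>\<^sup>+y. ennreal (gaussian_density (A *\<^sub>v \<mu>) S y) * h y \<partial>lborel_vec m)"
  proof (intro nn_integral_cong)
    fix y :: "real vec" assume "y \<in> space (lborel_vec m)"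
    then have y: "y \<in> carrier_vec m" by (simp add: space_lborel_vec)
    have "(\<lambda>x. ennreal (gaussian_density (A *\<^sub>v x) R y)) \<in> borel_measurable prior"
      by (rule measurable_likelihood_prior[OF y])
    then show "(\<integral>\<^sup>+x. h y * ennreal (gaussian_density (A *\<^sub>v x) R y) \<partial>prior) =
        ennreal (gaussian_density (A *\<^sub>v \<mu>) S y) * h y"
      by (simp only: nn_integral_cmult nn_integral_likelihood[OF y] mult.commute)
  qed
  also have "\<dots> = (\<integral>\<^sup>+y. h y \<partial>evidence_law A R prior)"
    by (rule nn_integral_evidence_law[OF h, symmetric])
  finally show ?thesis .
qed

end

section \<open>Eigenvalue bounds\<close>

lemma min_eigenvalue_pos:
  assumes S: "pos_def_mat n S" and n: "n \<ge> 1"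
  shows "min_eigenvalue S > 0"
proof -
  note c = pos_def_mat_carrier[OF S] pos_def_mat_sym[OF S]
  obtain v where v: "v \<in> carrier_vec n" "v \<bullet> v > 0" "v \<bullet> (S *\<^sub>v v) = min_eigenvalue S * (v \<bullet> v)"
    using eigenvalue_rayleigh[OF c(1) eigenvalue_min_eigenvalue[OF c n]] .
  have "v \<noteq> 0\<^sub>v n" using v(1,2) by auto
  then have "v \<bullet> (S *\<^sub>v v) > 0" using S v(1) by (simp add: pos_def_mat_def)
  then show ?thesis using v(2,3) by (simp add: zero_less_mult_iff)
qed

lemma max_eigenvalue_pos:
  assumes S: "pos_def_mat n S" and n: "n \<ge> 1"
  shows "max_eigenvalue S > 0"
proof -
  note c = pos_def_mat_carrier[OF S] pos_def_mat_sym[OF S]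
  obtain v where v: "v \<in> carrier_vec n" "v \<bullet> v > 0" "v \<bullet> (S *\<^sub>v v) = max_eigenvalue S * (v \<bullet> v)"
    using eigenvalue_rayleigh[OF c(1) eigenvalue_max_eigenvalue[OF c n]] .
  have "v \<noteq> 0\<^sub>v n" using v(1,2) by auto
  then have "v \<bullet> (S *\<^sub>v v) > 0" using S v(1) by (simp add: pos_def_mat_def)
  then show ?thesis using v(2,3) by (simp add: zero_less_mult_iff)
qed

section \<open>Singular values and the determinant bound\<close>

lemma gram_quadratic_form:
  fixes A :: "real mat"
  assumes A: "A \<in> carrier_mat m n" and v: "v \<in> carrier_vec n"
  shows "v \<bullet> ((transpose_mat A * A) *\<^sub>v v) = (A *\<^sub>v v) \<bullet> (A *\<^sub>v v)"
proof -
  have At: "transpose_mat A \<in> carrier_mat n m" and Av: "A *\<^sub>v v \<in> carrier_vec m" using A v by auto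
  have "v \<bullet> ((transpose_mat A * A) *\<^sub>v v) = v \<bullet> (transpose_mat A *\<^sub>v (A *\<^sub>v v))"
    using assoc_mult_mat_vec[OF At A v] by simp
  then show ?thesis using transpose_vec_mult_scalar[OF At Av v] by simp
qed

text \<open>The Gram matrix has nonnegative Rayleigh quotients, so its largest eigenvalue is
  nonnegative and squaring undoes \<open>sqrt\<close>, which is negative on negative
  arguments.\<close>

lemma
  fixes A :: "real mat"
  assumes A: "A \<in> carrier_mat m n" and n: "n \<ge> 1"
  shows max_singular_value_nonneg: "max_singular_value A \<ge> 0"
    and norm_mult_le_max_singular_value:
      "v \<in> carrier_vec n \<Longrightarrow> (A *\<^sub>v v) \<bullet> (A *\<^sub>v v) \<le> (max_singular_value A)\<^sup>2 * (v \<bullet> v)"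
proof -
  let ?G = "transpose_mat A * A"
  have c: "?G \<in> carrier_mat n n" using A by auto
  have s: "transpose_mat ?G = ?G"
    using A transpose_mult[of "transpose_mat A" n m A n] by simp
  obtain v where v: "v \<in> carrier_vec n" "v \<bullet> v > 0" "v \<bullet> (?G *\<^sub>v v) = max_eigenvalue ?G * (v \<bullet> v)"
    using eigenvalue_rayleigh[OF c eigenvalue_max_eigenvalue[OF c s n]] .
  have "max_eigenvalue ?G * (v \<bullet> v) \<ge> 0"
    unfolding v(3)[symmetric] gram_quadratic_form[OF A v(1)] by (rule scalar_prod_self_nonneg)
  then have nn: "max_eigenvalue ?G \<ge> 0" using v(2) by (simp add: zero_le_mult_iff)
  then show "max_singular_value A \<ge> 0" by (simp add: max_singular_value_def)
  have sq: "(max_singular_value A)\<^sup>2 = max_eigenvalue ?G"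
    using nn by (simp add: max_singular_value_def)
  show "(A *\<^sub>v v) \<bullet> (A *\<^sub>v v) \<le> (max_singular_value A)\<^sup>2 * (v \<bullet> v)" if v: "v \<in> carrier_vec n" for v
    unfolding sq using quadratic_form_le_max_eigenvalue[OF c s n v] gram_quadratic_form[OF A v] by simp
qed

text \<open>\<open>max_singular_value\<close> is defined through A^T A, whereas A \<Sigma> A^T calls
  for the norm of A^T. With u = A^T w, Cauchy-Schwarz gives |u|^2 = w \<bullet> A u \<le> |w|
  \<sigma>_1(A) |u|, and a factor |u| is cancelled unless u = 0.\<close>

lemma norm_transpose_mult_le_max_singular_value:
  fixes A :: "real mat"
  assumes A: "A \<in> carrier_mat m n" and n: "n \<ge> 1" and w: "w \<in> carrier_vec m"
  shows "(transpose_mat A *\<^sub>v w) \<bullet> (transpose_mat A *\<^sub>v w) \<le> (max_singular_value A)\<^sup>2 * (w \<bullet> w)"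
proof -
  define u where "u = transpose_mat A *\<^sub>v w"
  have u: "u \<in> carrier_vec n" using A w by (auto simp: u_def)
  have Au: "A *\<^sub>v u \<in> carrier_vec m" using A u by auto
  have "psd_mat m (1\<^sub>m m)"
    by (auto simp: psd_mat_def scalar_prod_self_nonneg)
  from psd_cauchy_schwarz[OF this w Au]
  have "(w \<bullet> (A *\<^sub>v u))\<^sup>2 \<le> (w \<bullet> w) * ((A *\<^sub>v u) \<bullet> (A *\<^sub>v u))"
    using w Au by (simp del: index_mult_mat_vec)
  also have "\<dots> \<le> (w \<bullet> w) * ((max_singular_value A)\<^sup>2 * (u \<bullet> u))"
    by (intro mult_left_mono norm_mult_le_max_singular_value[OF A n u] scalar_prod_self_nonneg)
  also have "w \<bullet> (A *\<^sub>v u) = u \<bullet> u"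
    using transpose_vec_mult_scalar[OF A u w] by (simp add: u_def)
  finally have *: "(u \<bullet> u) * (u \<bullet> u) \<le> ((max_singular_value A)\<^sup>2 * (w \<bullet> w)) * (u \<bullet> u)"
    by (simp add: power2_eq_square mult_ac)
  show ?thesis
  proof (cases "u \<bullet> u = 0")
    case True
    then show ?thesis using scalar_prod_self_nonneg[of w] by (simp add: u_def)
  next
    case False
    then have "u \<bullet> u > 0" using scalar_prod_self_nonneg[of u] by simp
    with * show ?thesis unfolding u_def by (simp only: mult_le_cancel_right_pos)
  qed
qed

text \<open>For u = A^T w the chain is u \<bullet> \<Sigma> u \<le> \<lambda>_1 |u|^2 \<le>
  \<lambda>_1 \<sigma>_1^2 |w|^2, and |w|^2 is at most w \<bullet> R w divided by the smallest
  eigenvalue of R. The exponent arises from det (c R) = c^m det R.\<close>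

lemma (in linear_gaussian_model) det_marginal_cov_bound:
  assumes m: "m \<ge> 1" and n: "n \<ge> 1"
  shows "det S / det R \<le> (1 + max_eigenvalue \<Sigma> / min_eigenvalue R * (max_singular_value A)\<^sup>2) ^ m"
proof -
  let ?s = "max_eigenvalue \<Sigma>" and ?r = "min_eigenvalue R" and ?a = "(max_singular_value A)\<^sup>2"
  define c where "c = 1 + ?s / ?r * ?a"
  have s: "?s > 0" and r: "?r > 0"
    using max_eigenvalue_pos[OF \<Sigma> n] min_eigenvalue_pos[OF R m] by auto
  have c: "c > 0" unfolding c_def using s r by (intro add_pos_nonneg) auto
  have "w \<bullet> (S *\<^sub>v w) \<le> w \<bullet> ((c \<cdot>\<^sub>m R) *\<^sub>v w)" if w: "w \<in> carrier_vec m" for w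
  proof -
    let ?u = "transpose_mat A *\<^sub>v w"
    have u: "?u \<in> carrier_vec n" using A w by auto
    have "?u \<bullet> (\<Sigma> *\<^sub>v ?u) \<le> ?s * (?u \<bullet> ?u)"
      by (rule quadratic_form_le_max_eigenvalue[OF pos_def_mat_carrier[OF \<Sigma>] pos_def_mat_sym[OF \<Sigma>] n u])
    also have "\<dots> \<le> ?s * (?a * (w \<bullet> w))"
      using norm_transpose_mult_le_max_singular_value[OF A n w] s by (intro mult_left_mono) auto
    also have "\<dots> = ?s / ?r * ?a * (?r * (w \<bullet> w))" using r by simp
    also have "\<dots> \<le> ?s / ?r * ?a * (w \<bullet> (R *\<^sub>v w))"
      using quadratic_form_ge_min_eigenvalue[OF pos_def_mat_carrier[OF R] pos_def_mat_sym[OF R] m w] s r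
      by (intro mult_left_mono) auto
    finally show ?thesis
      unfolding S_quadratic_form[OF w] quadratic_form_smult_mat[OF pos_def_mat_carrier[OF R] w] c_def
      by (simp add: algebra_simps)
  qed
  then have "det S \<le> det (c \<cdot>\<^sub>m R)"
    by (rule det_mono_loewner[OF S_pos_def pos_def_mat_smult[OF R c]])
  also have "\<dots> = c ^ m * det R" using pos_def_mat_carrier[OF R] by simp
  finally show ?thesis
    using pos_def_mat_det_pos[OF R] by (simp add: divide_le_eq c_def)
qed

text \<open>Adding 1 cannot lower a positive degree. If the product is constant, 1 might cancel it
  and leave a power of the zero polynomial; positivity at the single point x excludes this.\<close>

lemma degree_power_one_plus_smult:
  fixes p q :: "real poly"
  assumes "q \<noteq> 0" "p \<noteq> 0" "c > 0" "1 + c * (poly p x * (poly q x)\<^sup>2) > 0"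
  shows "degree ((1 + Polynomial.smult c (p * q\<^sup>2)) ^ m) = (2 * degree q + degree p) * m"
proof -
  let ?Q = "Polynomial.smult c (p * q\<^sup>2)"
  have dQ: "degree ?Q = 2 * degree q + degree p"
    using assms by (simp add: degree_mult_eq degree_power_eq)
  have "degree (1 + ?Q) = degree ?Q"
  proof (cases "degree ?Q = 0")
    case True
    then show ?thesis using degree_add_le[of 1 0 ?Q] by simp
  next
    case False
    then show ?thesis by (intro degree_add_eq_right) simp
  qed
  then have "degree (1 + ?Q) = 2 * degree q + degree p" using dQ by (rule trans)
  moreover have "1 + ?Q \<noteq> 0"
    using assms(4) by (metis less_irrefl poly_0 poly_1 poly_add poly_mult poly_power poly_smult)
  ultimately show ?thesis by (metis degree_power_eq mult.commute)
qed

text \<open>Dimensions start at 1 because a 0 by 0 matrix has empty spectrum, which would leave the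
  extremal eigenvalues unspecified. Each d has its own probability space, as the models of different
  dimensions are unrelated. The suprema are guarded by \<open>bdd_above\<close> because
  \<open>SUP\<close> on the reals is meaningful only for bounded families.\<close>

theorem mainTheorem6:
  fixes dy :: nat
    and \<mu>x :: "nat \<Rightarrow> real Matrix.vec"
    and \<Sigma>x A :: "nat \<Rightarrow> real Matrix.mat"
    and R :: "real Matrix.mat"
    and M :: "nat \<Rightarrow> 'w measure"
    and X V Y :: "nat \<Rightarrow> 'w \<Rightarrow> real Matrix.vec"
    and \<pi>0 :: "nat \<Rightarrow> real Matrix.vec measure"
  assumes dy: "dy \<ge> 1"
    and R: "pos_def_mat dy R"
    and \<mu>x: "\<And>d. d \<ge> 1 \<Longrightarrow> \<mu>x d \<in> carrier_vec d"
    and \<Sigma>x: "\<And>d. d \<ge> 1 \<Longrightarrow> pos_def_mat d (\<Sigma>x d)"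
    and A: "\<And>d. d \<ge> 1 \<Longrightarrow> A d \<in> carrier_mat dy d"
    and \<pi>0: "\<And>d. d \<ge> 1 \<Longrightarrow> \<pi>0 d = gaussian (\<mu>x d) (\<Sigma>x d)"
    and M: "\<And>d. d \<ge> 1 \<Longrightarrow> prob_space (M d)"
    and X_meas: "\<And>d. d \<ge> 1 \<Longrightarrow> X d \<in> measurable (M d) (lborel_vec d)"
    and X_law: "\<And>d. d \<ge> 1 \<Longrightarrow> distr (M d) (lborel_vec d) (X d) = \<pi>0 d"
    and V_meas: "\<And>d. d \<ge> 1 \<Longrightarrow> V d \<in> measurable (M d) (lborel_vec dy)"
    and V_law: "\<And>d. d \<ge> 1 \<Longrightarrow> distr (M d) (lborel_vec dy) (V d) = gaussian (0\<^sub>v dy) R"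
    and indep: "\<And>d. d \<ge> 1 \<Longrightarrow>
      prob_space.indep_var (M d) (lborel_vec d) (X d) (lborel_vec dy) (V d)"
    and Y: "\<And>d \<omega>. d \<ge> 1 \<Longrightarrow> \<omega> \<in> space (M d) \<Longrightarrow> Y d \<omega> = A d *\<^sub>v X d \<omega> + V d \<omega>"
  shows
    "(\<forall>d\<ge>1.
        K2 (A d) R (\<pi>0 d) = (\<integral>\<^sup>+\<omega>. L2_norm_sq (\<pi>0 d) (link (A d) R (\<pi>0 d) (Y d \<omega>)) \<partial>M d) \<and>
        K2 (A d) R (\<pi>0 d) =
          ennreal (Determinant.det (A d * \<Sigma>x d * transpose_mat (A d) + R) / Determinant.det R) \<and>
        K2 (A d) R (\<pi>0 d) < \<infinity>) \<and>
     (\<forall>d\<ge>1.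
        K2 (A d) R (\<pi>0 d) \<le>
          ennreal ((1 + max_eigenvalue (\<Sigma>x d) / min_eigenvalue R * (max_singular_value (A d))\<^sup>2) ^ dy)) \<and>
     (\<forall>(nA::nat) (n\<Sigma>::nat) (PA::real poly) (P\<Sigma>::real poly).
        degree PA = nA \<and> degree P\<Sigma> = n\<Sigma> \<and>
        (\<forall>d\<ge>1. max_singular_value (A d) \<le> poly PA (real d)) \<and>
        (\<forall>d\<ge>1. max_eigenvalue (\<Sigma>x d) \<le> poly P\<Sigma> (real d)) \<longrightarrow>
        (\<exists>P::real poly. degree P = (2 * nA + n\<Sigma>) * dy \<and>
           (\<forall>d\<ge>1. K2 (A d) R (\<pi>0 d) \<le> ennreal (poly P (real d))))) \<and>
     (bdd_above ((\<lambda>d. max_singular_value (A d)) ` {1..}) \<and>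
      bdd_above ((\<lambda>d. max_eigenvalue (\<Sigma>x d)) ` {1..}) \<longrightarrow>
        (\<forall>d\<ge>1. K2 (A d) R (\<pi>0 d) \<le>
           ennreal ((1 + (SUP d\<in>{1..}. max_eigenvalue (\<Sigma>x d)) *
             (SUP d\<in>{1..}. max_singular_value (A d))\<^sup>2 / min_eigenvalue R) ^ dy)))"
proof -
  let ?r = "min_eigenvalue R"
  define b where "b s t = (1 + s / ?r * t\<^sup>2) ^ dy" for s t
  have r: "?r > 0" by (rule min_eigenvalue_pos[OF R dy])
  have model: "linear_gaussian_model dy d (A d) (\<Sigma>x d) R (\<mu>x d)" if "d \<ge> 1" for d
    using A \<mu>x \<Sigma>x R that by unfold_locales auto
  have K2: "K2 (A d) R (\<pi>0 d) =
      ennreal (Determinant.det (A d * \<Sigma>x d * transpose_mat (A d) + R) / Determinant.det R)"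
    if "d \<ge> 1" for d
    using linear_gaussian_model.K2_eq[OF model[OF that]] \<pi>0[OF that] by (simp add: marginal_cov_def)
  have expectation: "K2 (A d) R (\<pi>0 d) =
      (\<integral>\<^sup>+\<omega>. L2_norm_sq (\<pi>0 d) (link (A d) R (\<pi>0 d) (Y d \<omega>)) \<partial>M d)" if d: "d \<ge> 1" for d
  proof -
    interpret linear_gaussian_model dy d "A d" "\<Sigma>x d" R "\<mu>x d" by (rule model[OF d])
    have "(\<integral>\<^sup>+\<omega>. L2_norm_sq (\<pi>0 d) (link (A d) R (\<pi>0 d) (Y d \<omega>)) \<partial>M d) =
        (\<integral>\<^sup>+\<omega>. L2_norm_sq prior (link (A d) R prior (A d *\<^sub>v X d \<omega> + V d \<omega>)) \<partial>M d)"
      using Y d by (intro nn_integral_cong) (simp add: \<pi>0)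
    also have "\<dots> = (\<integral>\<^sup>+y. L2_norm_sq prior (link (A d) R prior y) \<partial>evidence_law (A d) R prior)"
      by (rule nn_integral_observation_law[OF M X_meas _ V_meas V_law indep measurable_L2_norm_sq_link])
         (use d X_law \<pi>0 in simp_all)
    finally show ?thesis using \<pi>0[OF d] by (simp add: K2_def)
  qed
  have bound: "K2 (A d) R (\<pi>0 d) \<le> ennreal (b (max_eigenvalue (\<Sigma>x d)) (max_singular_value (A d)))"
    if d: "d \<ge> 1" for d
    unfolding K2[OF d] b_def
    using linear_gaussian_model.det_marginal_cov_bound[OF model[OF d] dy d]
    by (intro ennreal_leI) (simp add: marginal_cov_def)
  have eig: "max_eigenvalue (\<Sigma>x d) > 0" "max_singular_value (A d) \<ge> 0" if "d \<ge> 1" for d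
    using max_eigenvalue_pos[OF \<Sigma>x[OF that] that] max_singular_value_nonneg[OF A[OF that] that] by auto
  \<comment> \<open>The bound increases in both arguments on the nonnegative reals. The polynomial
    and the uniform estimate are two choices of the majorants s and t.\<close>
  have bound': "K2 (A d) R (\<pi>0 d) \<le> ennreal (b s t)"
    if d: "d \<ge> 1" and s: "max_eigenvalue (\<Sigma>x d) \<le> s" and t: "max_singular_value (A d) \<le> t" for d s t
  proof (rule order_trans[OF bound[OF d] ennreal_leI])
    show "b (max_eigenvalue (\<Sigma>x d)) (max_singular_value (A d)) \<le> b s t"
      unfolding b_def using eig[OF d] r s t
      by (intro power_mono add_left_mono mult_mono divide_right_mono add_nonneg_nonneg mult_nonneg_nonneg) auto
  qed
  have polynomial: "\<exists>P::real poly. degree P = (2 * degree PA + degree P\<Sigma>) * dy \<and>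
      (\<forall>d\<ge>1. K2 (A d) R (\<pi>0 d) \<le> ennreal (poly P (real d)))"
    if PA: "\<forall>d\<ge>1. max_singular_value (A d) \<le> poly PA (real d)"
      and P\<Sigma>: "\<forall>d\<ge>1. max_eigenvalue (\<Sigma>x d) \<le> poly P\<Sigma> (real d)" for PA P\<Sigma> :: "real poly"
  proof -
    \<comment> \<open>The zero polynomial has degree 0 here, so it is replaced by a nonzero constant.\<close>
    define q where "q = (if PA = 0 then 1 else PA)"
    have q: "q \<noteq> 0" "degree q = degree PA" by (auto simp: q_def)
    have q_le: "max_singular_value (A d) \<le> poly q (real d)" if "d \<ge> 1" for d
      using PA that by (cases "PA = 0") (auto simp: q_def intro: order_trans[of _ 0 1])
    define P where "P = (1 + Polynomial.smult (1 / ?r) (P\<Sigma> * q\<^sup>2)) ^ dy"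
    \<comment> \<open>Dimension 1 already forces this, since the prior covariance is positive
      definite there. It excludes the zero polynomial and supplies the point of positivity for the
      degree count.\<close>
    have pos: "poly P\<Sigma> 1 > 0"
      using P\<Sigma>[rule_format, of 1] eig(1)[of 1] by simp
    then have "P\<Sigma> \<noteq> 0" by auto
    then have "degree P = (2 * degree PA + degree P\<Sigma>) * dy"
      unfolding P_def using degree_power_one_plus_smult[of q P\<Sigma> "1 / ?r" 1 dy] q r pos
      by (simp add: add_pos_nonneg)
    moreover have "poly P (real d) = b (poly P\<Sigma> (real d)) (poly q (real d))" for d
      by (simp add: P_def b_def)
    ultimately show ?thesis
      using bound' q_le P\<Sigma> by (intro exI[of _ P]) simp
  qed
  have uniform: "K2 (A d) R (\<pi>0 d) \<le>
      ennreal ((1 + (SUP d\<in>{1..}. max_eigenvalue (\<Sigma>x d)) *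
        (SUP d\<in>{1..}. max_singular_value (A d))\<^sup>2 / ?r) ^ dy)"
    if bdd: "bdd_above ((\<lambda>d. max_singular_value (A d)) ` {1..})"
      "bdd_above ((\<lambda>d. max_eigenvalue (\<Sigma>x d)) ` {1..})" and d: "d \<ge> 1" for d
    using bound'[OF d cSUP_upper[OF _ bdd(2)] cSUP_upper[OF _ bdd(1)]] d by (simp add: b_def)
  have finite: "K2 (A d) R (\<pi>0 d) < \<infinity>" if "d \<ge> 1" for d
    unfolding K2[OF that] by simp
  show ?thesis
    by (intro conjI allI impI; (elim conjE)?)
       (use expectation K2 finite bound[unfolded b_def] polynomial uniform in blast)+
qed

end
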